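(* There exists a constant $d$ such that for every $N$ and all binary strings $a,b,c$ of length at most $N$ satisfying $$\mathrm{KS}(a\mid c)\ge \mathrm{KS}(b\mid c)+\mathrm{KS}(b\mid a)+d\log N$$ there exists a binary string $f$ of length at most $\mathrm{KS}(b\mid a)+d\log N$ such that $\mathrm{KS}(b\mid a,f)\le d\log N$ and $\mathrm{KS}(b\mid c,f)\ge \mathrm{KS}(b\mid c)-d\log N$.
   Context: $\mathrm{KS}(u\mid v)$ denotes conditional Kolmogorov complexity of binary strings with respect to a fixed optimal programming language; conditioning on two strings means conditioning on an encoding of the pair.
   Formalization: The theorem is stated for N at least 2 and logarithms to base 2; for N = 0 the logarithm is undefined, and for N = 1 it vanishes, so the claim would demand KS(b|a,f) = 0, which fails for some optimal languages. *)

theory Defs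
  imports Complex_Main
begin

datatype recf = Zero | Succ | Proj nat | Comp recf "recf list" | Prim recf recf | Mn recf

inductive eval :: "recf \<Rightarrow> nat list \<Rightarrow> nat \<Rightarrow> bool"
  and evals :: "recf list \<Rightarrow> nat list \<Rightarrow> nat list \<Rightarrow> bool" where
  "eval Zero xs 0"
| "eval Succ (x # xs) (Suc x)"
| "i < length xs \<Longrightarrow> eval (Proj i) xs (xs ! i)"
| "evals gs xs ys \<Longrightarrow> eval f ys z \<Longrightarrow> eval (Comp f gs) xs z"
| "eval f xs z \<Longrightarrow> eval (Prim f g) (0 # xs) z"
| "eval (Prim f g) (n # xs) r \<Longrightarrow> eval g (r # n # xs) z \<Longrightarrow> eval (Prim f g) (Suc n # xs) z"
| "eval f (n # xs) 0 \<Longrightarrow> (\<forall>m<n. \<exists>v. eval f (m # xs) v \<and> v \<noteq> 0) \<Longrightarrow> eval (Mn f) xs n"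
| "evals [] xs []"
| "eval g xs y \<Longrightarrow> evals gs xs ys \<Longrightarrow> evals (g # gs) xs (y # ys)"

type_synonym bstr = "bool list"

text \<open>Bijective encoding of binary strings by natural numbers.\<close>
fun enc :: "bstr \<Rightarrow> nat" where
  "enc [] = 0"
| "enc (b # xs) = 2 * enc xs + (if b then 2 else 1)"

definition pair_str :: "bstr \<Rightarrow> bstr \<Rightarrow> bstr" where
  "pair_str a f = concat (map (\<lambda>b. [b, b]) a) @ [False, True] @ f"

text \<open>Conditional decompressors: program, condition \<mapsto> output (partial).\<close>
definition computable_dec :: "(bstr \<Rightarrow> bstr \<Rightarrow> bstr option) \<Rightarrow> bool" where
  "computable_dec D \<longleftrightarrow> (\<exists>F. \<forall>p y z. D p y = Some z \<longleftrightarrow> eval F [enc p, enc y] (enc z))"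

definition optimal_dec :: "(bstr \<Rightarrow> bstr \<Rightarrow> bstr option) \<Rightarrow> bool" where
  "optimal_dec U \<longleftrightarrow> computable_dec U \<and>
     (\<forall>D. computable_dec D \<longrightarrow>
        (\<exists>c. \<forall>p y x. D p y = Some x \<longrightarrow> (\<exists>q. U q y = Some x \<and> length q \<le> length p + c)))"

definition KS :: "(bstr \<Rightarrow> bstr \<Rightarrow> bstr option) \<Rightarrow> bstr \<Rightarrow> bstr \<Rightarrow> nat" where
  "KS U x y = (LEAST n. \<exists>p. length p = n \<and> U p y = Some x)"

end

theory Submission
  imports Defs "HOL-Library.Nat_Bijection" "HOL-Library.FuncSet"
begin

text \<open>Put \<open>m = KS(b|a)\<close> and \<open>l = KS(b|c)\<close>. A shortest program \<open>p\<close> of \<open>b\<close> relative to \<open>a\<close> is masked: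
  \<open>f = p + h\<^sub>r(a)\<close> modulo \<open>2 ^ m\<close>, where \<open>h\<close> is a computable hash table with polynomially many seeds \<open>r\<close>.
  Given \<open>a\<close>, \<open>f\<close> and the seed, \<open>b\<close> is recovered. Suppose that for every seed \<open>f\<close> makes \<open>b\<close> simple
  relative to \<open>c\<close>. If at least half of all strings of length \<open>m\<close> have this property, then \<open>b\<close> belongs
  to a small set enumerable from \<open>c\<close>, which contradicts the value of \<open>l\<close>. Otherwise these strings form a
  set of density at most one half; a random table, hence also the first one found by exhaustive search,
  leaves fewer than \<open>2 ^ m\<close> strings \<open>a\<close> for which some mask hits such a set for all seeds. Then \<open>a\<close> is
  determined by \<open>c\<close>, a program of \<open>b\<close> and \<open>m\<close> further bits, which contradicts the lower bound on
  \<open>KS(a|c)\<close>.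

  Enumerations need no universal function: every fixed recursive function has a total clocked version.\<close>

section \<open>Clocked evaluation\<close>

text \<open>The value \<open>0\<close> means that no result is found within the search bound \<open>t\<close>, and \<open>Suc z\<close> is the result \<open>z\<close>.\<close>

primrec clocked :: "recf \<Rightarrow> nat \<Rightarrow> nat list \<Rightarrow> nat" where
  "clocked Zero t xs = 1"
| "clocked Succ t xs = (case xs of [] \<Rightarrow> 0 | x # _ \<Rightarrow> Suc (Suc x))"
| "clocked (Proj i) t xs = (if i < length xs then Suc (xs ! i) else 0)"
| "clocked (Comp f gs) t xs =
     (let ys = map (\<lambda>c. c t xs) (map clocked gs)
      in if 0 \<in> set ys then 0 else clocked f t (map (\<lambda>y. y - 1) ys))"
| "clocked (Prim f g) t xs =
     (case xs of [] \<Rightarrow> 0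
      | n # zs \<Rightarrow> rec_nat (clocked f t zs) (\<lambda>i r. if r = 0 then 0 else clocked g t ((r - 1) # i # zs)) n)"
| "clocked (Mn f) t xs =
     (let z = (LEAST z. t \<le> z \<or> clocked f t (z # xs) \<le> 1)
      in if z < t \<and> clocked f t (z # xs) = 1 then Suc z else 0)"

text \<open>The test \<open>\<le> 1\<close> stops the search at the value 1, which is the result
  zero, and at 0, which is a missing result. Values above 1 below \<open>z\<close> therefore say
  that all earlier arguments give defined nonzero results.\<close>

lemma Least_search_eq:
  assumes "clocked f t (z # xs) = 1" "z < t" "\<forall>m<z. 1 < clocked f t (m # xs)"
  shows "(LEAST z. t \<le> z \<or> clocked f t (z # xs) \<le> 1) = z"
  by (rule Least_equality) (use assms in \<open>auto simp: not_less[symmetric]\<close>)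

lemma clocked_MnI:
  assumes "clocked f t (z # xs) = 1" "z < t" "\<forall>m<z. 1 < clocked f t (m # xs)"
  shows "clocked (Mn f) t xs = Suc z"
  unfolding clocked.simps Least_search_eq[OF assms] using assms by (simp add: Let_def)

lemma clocked_MnD:
  assumes "clocked (Mn f) t xs = Suc z"
  shows "clocked f t (z # xs) = 1" "z < t" "\<forall>m<z. 1 < clocked f t (m # xs)"
proof -
  define w where "w = (LEAST z. t \<le> z \<or> clocked f t (z # xs) \<le> 1)"
  have w: "w < t" "clocked f t (w # xs) = 1" "w = z"
    using assms unfolding clocked.simps Let_def w_def[symmetric] by (auto split: if_splits)
  show "clocked f t (z # xs) = 1" "z < t" using w by auto
  show "\<forall>m<z. 1 < clocked f t (m # xs)"
  proof (intro allI impI)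
    fix m assume "m < z"
    then have "\<not> (t \<le> m \<or> clocked f t (m # xs) \<le> 1)"
      using w not_less_Least[of m] unfolding w_def by blast
    then show "1 < clocked f t (m # xs)" by simp
  qed
qed

text \<open>The bound enters only through the search of \<open>Mn\<close>. The values before its
  result are defined and nonzero; by induction they stay the same under a larger bound, so the same
  result is found.\<close>

lemma clocked_mono: "clocked F t xs = Suc z \<Longrightarrow> t \<le> t' \<Longrightarrow> clocked F t' xs = Suc z"
proof (induction F arbitrary: xs z)
  case (Comp f gs)
  have g: "clocked g t' xs = clocked g t xs" if "g \<in> set gs" for g
  proof -
    have "clocked g t xs \<noteq> 0" using Comp.prems(1) that by (auto simp: Let_def image_iff split: if_splits)
    then obtain y where "clocked g t xs = Suc y" by (cases "clocked g t xs") auto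
    then show ?thesis using Comp.IH(2)[OF that] Comp.prems(2) by auto
  qed
  have m: "map (\<lambda>c. c t' xs) (map clocked gs) = map (\<lambda>c. c t xs) (map clocked gs)"
    using g by simp
  show ?case using Comp.prems Comp.IH(1) unfolding clocked.simps m Let_def
    by (auto split: if_splits)
next
  case (Prim f g)
  then obtain n zs where xs: "xs = n # zs" by (cases xs) auto
  show ?case using Prim.prems unfolding xs
  proof (induction n arbitrary: z)
    case 0
    then show ?case using Prim.IH(1) by auto
  next
    case (Suc n)
    then obtain r where r: "clocked (Prim f g) t (n # zs) = Suc r"
      by (cases "clocked (Prim f g) t (n # zs)") auto
    from Suc.IH[OF this Suc.prems(2)] r Suc.prems Prim.IH(2) show ?case by auto
  qed
next
  case (Mn f)
  note D = clocked_MnD[OF Mn.prems(1)]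
  show ?case
  proof (rule clocked_MnI)
    show "clocked f t' (z # xs) = 1" using Mn.IH[of "z#xs" 0] D(1) Mn.prems(2) by simp
    show "z < t'" using D Mn.prems by simp
    show "\<forall>m<z. 1 < clocked f t' (m # xs)"
    proof (intro allI impI)
      fix m assume "m < z"
      then have "1 < clocked f t (m # xs)" using D(3) by blast
      then obtain v where v: "clocked f t (m # xs) = Suc v" "v \<noteq> 0" by (cases "clocked f t (m # xs)") auto
      then show "1 < clocked f t' (m # xs)" using Mn.IH[OF v(1) Mn.prems(2)] by simp
    qed
  qed
qed (auto split: list.splits if_splits)

lemma evals_map:
  "(\<And>g. g \<in> set gs \<Longrightarrow> eval g xs (y g)) \<Longrightarrow> evals gs xs (map y gs)"
  by (induction gs) (auto intro: eval_evals.intros)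

lemma clocked_sound: "clocked F t xs = Suc z \<Longrightarrow> eval F xs z"
proof (induction F arbitrary: xs z)
  case Zero
  then show ?case by (auto intro: eval_evals.intros)
next
  case Succ
  then show ?case by (auto intro: eval_evals.intros split: list.splits)
next
  case (Proj i)
  then show ?case by (auto intro: eval_evals.intros split: if_splits)
next
  case (Comp f gs)
  have "evals gs xs (map (\<lambda>g. clocked g t xs - 1) gs)"
  proof (rule evals_map)
    fix g assume g: "g \<in> set gs"
    then have "clocked g t xs \<noteq> 0" using Comp.prems by (auto simp: Let_def image_iff split: if_splits)
    then show "eval g xs (clocked g t xs - 1)" using Comp.IH(2)[OF g] by simp
  qed
  moreover have "eval f (map (\<lambda>g. clocked g t xs - 1) gs) z"
    using Comp.prems by (intro Comp.IH(1)) (auto simp: Let_def o_def split: if_splits)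
  ultimately show ?case by (rule eval_evals.intros)
next
  case (Prim f g)
  then obtain n zs where xs: "xs = n # zs" by (cases xs) auto
  show ?case using Prim.prems unfolding xs
  proof (induction n arbitrary: z)
    case 0
    then show ?case using Prim.IH(1) by (auto intro: eval_evals.intros)
  next
    case (Suc n)
    then obtain r where r: "clocked (Prim f g) t (n # zs) = Suc r"
      by (cases "clocked (Prim f g) t (n # zs)") auto
    from Suc.IH[OF this] r Suc.prems Prim.IH(2) show ?case by (auto intro: eval_evals.intros)
  qed
next
  case (Mn f)
  note D = clocked_MnD[OF Mn.prems(1)]
  show ?case
  proof (rule eval_evals.intros(7))
    show "eval f (z # xs) 0" using D(1) by (intro Mn.IH) simp
    show "\<forall>m<z. \<exists>v. eval f (m # xs) v \<and> v \<noteq> 0"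
    proof (intro allI impI)
      fix m assume "m < z"
      then have "1 < clocked f t (m # xs)" using D(3) by blast
      then obtain v where v: "clocked f t (m # xs) = Suc v" "v \<noteq> 0" by (cases "clocked f t (m # xs)") auto
      then show "\<exists>v. eval f (m # xs) v \<and> v \<noteq> 0" using Mn.IH[OF v(1)] by blast
    qed
  qed
qed

text \<open>Merges finitely many monotone events into one common stage by taking maxima. It serves
  the arguments before a minimum, the indices of a revealing set and the seeds of the hash table
  alike.\<close>

lemma uniform_stage:
  fixes P :: "nat \<Rightarrow> nat \<Rightarrow> bool"
  assumes "\<And>m. m < n \<Longrightarrow> \<exists>t. P t m" "\<And>t t' m. P t m \<Longrightarrow> t \<le> t' \<Longrightarrow> P t' m"
  shows "\<exists>t\<ge>t0. \<forall>m<n. P t m"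
  using assms(1)
proof (induction n)
  case 0
  then show ?case by auto
next
  case (Suc n)
  then obtain t where t: "t \<ge> t0" "\<forall>m<n. P t m" by auto
  obtain t1 where t1: "P t1 n" using Suc.prems by auto
  show ?case
    by (rule exI[of _ "max t t1"]) (use t t1 assms(2) in \<open>auto simp: less_Suc_eq\<close>)
qed

text \<open>Induction over the derivation: the bounds of the premises are replaced by a common
  larger one, where \<open>clocked_mono\<close> keeps all results.\<close>

lemma clocked_complete_aux:
  "eval F xs z \<Longrightarrow> \<exists>t. clocked F t xs = Suc z"
  "evals gs xs ys \<Longrightarrow> \<exists>t. map (\<lambda>g. clocked g t xs) gs = map Suc ys"
proof (induction rule: eval_evals.inducts)
  case (4 gs xs ys f z)
  then obtain t1 t2 where t: "map (\<lambda>g. clocked g t1 xs) gs = map Suc ys" "clocked f t2 ys = Suc z" by blast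
  define t where "t = max t1 t2"
  have "map (\<lambda>g. clocked g t xs) gs = map Suc ys"
  proof (rule nth_equalityI)
    fix i assume "i < length (map (\<lambda>g. clocked g t xs) gs)"
    then have i: "i < length gs" by simp
    have "clocked (gs ! i) t1 xs = Suc (ys ! i)" using t(1) i
      by (metis length_map nth_map)
    then have "clocked (gs ! i) t xs = Suc (ys ! i)" by (rule clocked_mono) (simp add: t_def)
    then show "map (\<lambda>g. clocked g t xs) gs ! i = map Suc ys ! i" using i t(1)
      by (metis length_map nth_map)
  qed (use t(1) in \<open>metis length_map\<close>)
  moreover have "clocked f t ys = Suc z" by (rule clocked_mono[OF t(2)]) (simp add: t_def)
  ultimately have "clocked (Comp f gs) t xs = Suc z"
    by (auto simp: Let_def o_def)
  then show ?case by blast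
next
  case (6 f g n xs r z)
  then obtain t1 t2 where t: "clocked (Prim f g) t1 (n # xs) = Suc r" "clocked g t2 (r # n # xs) = Suc z" by blast
  define t where "t = max t1 t2"
  have "clocked (Prim f g) t (n # xs) = Suc r" by (rule clocked_mono[OF t(1)]) (simp add: t_def)
  moreover have "clocked g t (r # n # xs) = Suc z" by (rule clocked_mono[OF t(2)]) (simp add: t_def)
  ultimately have "clocked (Prim f g) t (Suc n # xs) = Suc z" by simp
  then show ?case by blast
next
  case (7 f n xs)
  then obtain t0 where t0: "clocked f t0 (n # xs) = Suc 0" by blast
  \<comment> \<open>The search accepts only results below the bound, so the bound has to exceed
    \<open>n\<close> itself.\<close>
  have "\<exists>t\<ge>max t0 (Suc n). \<forall>m<n. \<exists>v. clocked f t (m # xs) = Suc v \<and> v \<noteq> 0"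
  proof (rule uniform_stage)
    fix m assume "m < n"
    then show "\<exists>t v. clocked f t (m # xs) = Suc v \<and> v \<noteq> 0" using 7 by blast
  qed (use clocked_mono in blast)
  then obtain t where t: "t \<ge> max t0 (Suc n)" "\<forall>m<n. \<exists>v. clocked f t (m # xs) = Suc v \<and> v \<noteq> 0" by blast
  have "clocked (Mn f) t xs = Suc n"
    by (rule clocked_MnI) (use clocked_mono[OF t0, of t] t in force)+
  then show ?case by blast
next
  case (9 g xs y gs ys)
  then obtain t1 t2 where t: "clocked g t1 xs = Suc y" "map (\<lambda>g. clocked g t2 xs) gs = map Suc ys" by blast
  define t where "t = max t1 t2"
  have "map (\<lambda>g. clocked g t xs) gs = map Suc ys"
  proof (rule nth_equalityI)
    fix i assume "i < length (map (\<lambda>g. clocked g t xs) gs)"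
    then have i: "i < length gs" by simp
    have "clocked (gs ! i) t2 xs = Suc (ys ! i)" using t(2) i
      by (metis length_map nth_map)
    then have "clocked (gs ! i) t xs = Suc (ys ! i)" by (rule clocked_mono) (simp add: t_def)
    then show "map (\<lambda>g. clocked g t xs) gs ! i = map Suc ys ! i" using i t(2)
      by (metis length_map nth_map)
  qed (use t(2) in \<open>metis length_map\<close>)
  moreover have "clocked g t xs = Suc y" by (rule clocked_mono[OF t(1)]) (simp add: t_def)
  ultimately show ?case by auto
qed auto

lemma eval_iff_ck: "eval F xs z \<longleftrightarrow> (\<exists>t. clocked F t xs = Suc z)"
  using clocked_complete_aux(1) clocked_sound by blast

text \<open>Both results persist at the larger of the two bounds. Determinism of \<open>eval\<close>
  follows without an induction over two derivations.\<close>

lemma clocked_det: "clocked F t xs = Suc z \<Longrightarrow> clocked F t' xs = Suc z' \<Longrightarrow> z = z'"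
  using clocked_mono[of F t xs z "max t t'"] clocked_mono[of F t' xs z' "max t t'"] by simp

lemma eval_det: "eval F xs z \<Longrightarrow> eval F xs z' \<Longrightarrow> z = z'"
  unfolding eval_iff_ck using clocked_det by blast

section \<open>Total computable functions\<close>

text \<open>Functions of $n$ variables take an environment \<open>e\<close> whose entry \<open>e i\<close> is the value of the
  \<open>i\<close>-th variable, so that passing under a binder is a shift \<open>e \<circ> Suc\<close> and amounts to beta reduction.\<close>

definition computable :: "nat \<Rightarrow> ((nat \<Rightarrow> nat) \<Rightarrow> nat) \<Rightarrow> bool" where
  "computable n f \<longleftrightarrow> (\<exists>F. \<forall>e. eval F (map e [0..<n]) (f e))"

definition decidable :: "nat \<Rightarrow> ((nat \<Rightarrow> nat) \<Rightarrow> bool) \<Rightarrow> bool" where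
  "decidable n P \<longleftrightarrow> computable n (\<lambda>e. of_bool (P e))"

named_theorems computable_intros

section \<open>Substitution, primitive recursion and minimisation\<close>

lemma computable_var [computable_intros]: "i < n \<Longrightarrow> computable n (\<lambda>e. e i)"
  unfolding computable_def using eval_evals.intros(3)[of i "map _ [0..<n]"]
  by (intro exI[of _ "Proj i"]) (metis (no_types, lifting) add_0 diff_zero length_map length_upt nth_map_upt)

lemma computable_comp:
  assumes "computable k g" "\<And>i. i < k \<Longrightarrow> computable n (a i)"
  shows "computable n (\<lambda>e. g (\<lambda>i. a i e))"
proof -
  obtain G where G: "\<And>e. eval G (map e [0..<k]) (g e)" using assms(1) unfolding computable_def by blast
  have "\<forall>i. \<exists>F. i < k \<longrightarrow> (\<forall>e. eval F (map e [0..<n]) (a i e))" using assms(2) unfolding computable_def by blast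
  then obtain H where H: "\<And>i e. i < k \<Longrightarrow> eval (H i) (map e [0..<n]) (a i e)" by metis
  have "evals (map H js) (map e [0..<n]) (map (\<lambda>i. a i e) js)" if "set js \<subseteq> {..<k}" for e js
    using that by (induction js) (auto intro: eval_evals.intros H)
  from this[where js="[0..<k]"]
  have "evals (map H [0..<k]) (map e [0..<n]) (map (\<lambda>i. a i e) [0..<k])" for e
    by (simp add: atLeast0LessThan)
  then have "eval (Comp G (map H [0..<k])) (map e [0..<n]) (g (\<lambda>i. a i e))" for e
    using G eval_evals.intros(4) by blast
  then show ?thesis unfolding computable_def by blast
qed

lemma computable_comp1: "computable 1 (\<lambda>e. g (e 0)) \<Longrightarrow> computable n a \<Longrightarrow> computable n (\<lambda>e. g (a e))"
  using computable_comp[of 1 "\<lambda>e. g (e 0)" n "\<lambda>i. a"] by simp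

lemma computable_comp2:
  assumes "computable 2 (\<lambda>e. g (e 0) (e 1))" "computable n a" "computable n b"
  shows "computable n (\<lambda>e. g (a e) (b e))"
proof -
  have "computable n ([a, b] ! i)" if "i < 2" for i using assms(2,3) that by (auto simp: less_2_cases_iff)
  from computable_comp[where a="\<lambda>i. [a, b] ! i", OF assms(1) this] show ?thesis by simp
qed

lemma computable_comp3:
  assumes "computable 3 (\<lambda>e. g (e 0) (e 1) (e 2))" "computable n a" "computable n b" "computable n c"
  shows "computable n (\<lambda>e. g (a e) (b e) (c e))"
proof -
  have "computable n ([a, b, c] ! i)" if "i < 3" for i
    using assms(2-) that by (auto simp: numeral_eq_Suc less_Suc_eq)
  from computable_comp[where a="\<lambda>i. [a, b, c] ! i", OF assms(1) this] show ?thesis by simp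
qed

lemma computable_comp4:
  assumes "computable 4 (\<lambda>e. g (e 0) (e 1) (e 2) (e 3))" "computable n a" "computable n b" "computable n c" "computable n d"
  shows "computable n (\<lambda>e. g (a e) (b e) (c e) (d e))"
proof -
  have "computable n ([a, b, c, d] ! i)" if "i < 4" for i
    using assms(2-) that by (auto simp: numeral_eq_Suc less_Suc_eq)
  from computable_comp[where a="\<lambda>i. [a, b, c, d] ! i", OF assms(1) this] show ?thesis by simp
qed

lemma computable_Suc [computable_intros]:
  assumes "computable n a" shows "computable n (\<lambda>e. Suc (a e))"
proof (rule computable_comp1[OF _ assms])
  show "computable 1 (\<lambda>e. Suc (e 0))" unfolding computable_def by (intro exI[of _ Succ]) (auto intro: eval_evals.intros)
qed

lemma computable_const [computable_intros]: "computable n (\<lambda>e. k)"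
proof (induction k)
  case 0
  show ?case unfolding computable_def by (intro exI[of _ Zero]) (auto intro: eval_evals.intros)
qed (rule computable_Suc)

lemma map_upt_shift: "map e [0..<Suc n] = e 0 # map (\<lambda>j. e (Suc j)) [0..<n]"
  by (simp add: map_upt_Suc del: upt_Suc)

text \<open>In the step function \<open>e 0\<close> is the previous value and \<open>e 1\<close> the
  counter, which is the argument order \<open>r # n # xs\<close> of \<open>Prim\<close>.\<close>

lemma computable_prim [computable_intros]:
  assumes "computable n b" "computable n f" "computable (Suc (Suc n)) (\<lambda>e. g (e 1) (e 0) (\<lambda>j. e (Suc (Suc j))))"
  shows "computable n (\<lambda>e. rec_nat (f e) (\<lambda>i r. g i r e) (b e))"
proof -
  obtain F where F: "\<And>e. eval F (map e [0..<n]) (f e)" using assms(2) unfolding computable_def by blast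
  obtain G where G: "\<And>e. eval G (map e [0..<Suc (Suc n)]) (g (e 1) (e 0) (\<lambda>j. e (Suc (Suc j))))"
    using assms(3) unfolding computable_def by blast
  have G': "eval G (r # i # map e [0..<n]) (g i r e)" for r i e
    using G[of "\<lambda>k. case k of 0 \<Rightarrow> r | Suc 0 \<Rightarrow> i | Suc (Suc j) \<Rightarrow> e j"]
    by (simp add: map_upt_shift del: upt_Suc)
  have "eval (Prim F G) (k # map e [0..<n]) (rec_nat (f e) (\<lambda>i r. g i r e) k)" for k e
    by (induction k) (auto intro: eval_evals.intros F G')
  \<comment> \<open>The recursion count is first a variable of its own, placed at
    \<open>e 0\<close>; the composition at the end replaces it by \<open>b\<close>.\<close>
  then have "computable (Suc n) (\<lambda>e. rec_nat (f (\<lambda>j. e (Suc j))) (\<lambda>i r. g i r (\<lambda>j. e (Suc j))) (e 0))"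
    unfolding computable_def map_upt_shift by blast
  moreover have "computable n (case i of 0 \<Rightarrow> b | Suc j \<Rightarrow> (\<lambda>e. e j))" if "i < Suc n" for i
    using that assms(1) by (auto split: nat.splits intro: computable_var)
  ultimately show ?thesis
    using computable_comp[where n = n and a = "\<lambda>i. case i of 0 \<Rightarrow> b | Suc j \<Rightarrow> (\<lambda>e. e j)"] by fastforce
qed

lemma computable_mu:
  assumes "decidable (Suc n) (\<lambda>e. P (e 0) (\<lambda>j. e (Suc j)))" "\<And>e. \<exists>z. P z e"
  shows "computable n (\<lambda>e. LEAST z. P z e)"
proof -
  \<comment> \<open>\<open>Mn\<close> looks for a zero, so truth values must be negated. General
    subtraction is derived only later; for \<open>1 - x\<close> one recursion suffices.\<close>
  have "computable 1 (\<lambda>e. rec_nat 1 (\<lambda>i r. 0) (e 0))" by (rule computable_intros | simp)+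
  then have 1: "computable 1 (\<lambda>e. 1 - e 0)"
  proof -
    have "rec_nat 1 (\<lambda>i r. 0) k = 1 - k" for k :: nat by (cases k) auto
    then show ?thesis using \<open>computable 1 _\<close> by simp
  qed
  obtain F where F: "\<And>e. eval F (map e [0..<Suc n]) (1 - of_bool (P (e 0) (\<lambda>j. e (Suc j))))"
    using computable_comp1[OF 1 assms(1)[unfolded decidable_def]] unfolding computable_def by blast
  have F': "eval F (z # map e [0..<n]) (1 - of_bool (P z e))" for z e
    using F[of "case_nat z e"] by (simp add: map_upt_shift del: upt_Suc)
  have "eval (Mn F) (map e [0..<n]) (LEAST z. P z e)" for e
  proof (rule eval_evals.intros(7))
    show "eval F ((LEAST z. P z e) # map e [0..<n]) 0"
      using F'[of "LEAST z. P z e" e] LeastI_ex[OF assms(2)[of e]] by simp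
    show "\<forall>m<LEAST z. P z e. \<exists>v. eval F (m # map e [0..<n]) v \<and> v \<noteq> 0"
      using F'[of _ e] not_less_Least[of _ "\<lambda>z. P z e"] by (metis diff_zero of_bool_eq_0_iff one_neq_zero)
  qed
  then show ?thesis unfolding computable_def by blast
qed

section \<open>Arithmetic, logic and pairing\<close>

lemma computable_add [computable_intros]: "computable n a \<Longrightarrow> computable n b \<Longrightarrow> computable n (\<lambda>e. a e + b e)"
proof -
  assume *: "computable n a" "computable n b"
  have "rec_nat x (\<lambda>i r. Suc r) y = x + y" for x y :: nat by (induction y) auto
  moreover have "computable n (\<lambda>e. rec_nat (a e) (\<lambda>i r. Suc r) (b e))" by (rule computable_intros * | simp)+
  ultimately show ?thesis by simp
qed

lemma computable_mult [computable_intros]: "computable n a \<Longrightarrow> computable n b \<Longrightarrow> computable n (\<lambda>e. a e * b e)"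
proof -
  have "rec_nat 0 (\<lambda>i r. r + x) y = x * y" for x y :: nat by (induction y) auto
  moreover have "computable 2 (\<lambda>e. rec_nat 0 (\<lambda>i r. r + e 0) (e 1))" by (rule computable_intros | simp)+
  ultimately have "computable 2 (\<lambda>e. e 0 * e 1)" by simp
  then show "computable n a \<Longrightarrow> computable n b \<Longrightarrow> ?thesis" by (rule computable_comp2)
qed

lemma computable_pow [computable_intros]: "computable n a \<Longrightarrow> computable n b \<Longrightarrow> computable n (\<lambda>e. a e ^ b e)"
proof -
  have "rec_nat 1 (\<lambda>i r. r * x) y = x ^ y" for x y :: nat by (induction y) auto
  moreover have "computable 2 (\<lambda>e. rec_nat 1 (\<lambda>i r. r * e 0) (e 1))" by (rule computable_intros | simp)+
  ultimately have "computable 2 (\<lambda>e. e 0 ^ e 1)" by simp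
  then show "computable n a \<Longrightarrow> computable n b \<Longrightarrow> ?thesis" by (rule computable_comp2)
qed

lemma computable_diff [computable_intros]: "computable n a \<Longrightarrow> computable n b \<Longrightarrow> computable n (\<lambda>e. a e - b e)"
proof -
  have "rec_nat 0 (\<lambda>i r. i) y = y - 1" for y :: nat by (cases y) auto
  moreover have "computable 1 (\<lambda>e. rec_nat 0 (\<lambda>i r. i) (e 0))" by (rule computable_intros | simp)+
  ultimately have p: "computable 1 (\<lambda>e. e 0 - 1)" by simp
  have "rec_nat x (\<lambda>i r. r - 1) y = x - y" for x y :: nat by (induction y) auto
  moreover have "computable 2 (\<lambda>e. rec_nat (e 0) (\<lambda>i r. r - 1) (e 1))" by (rule computable_intros computable_comp1[OF p] | simp)+
  ultimately have "computable 2 (\<lambda>e. e 0 - e 1)" by simp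
  then show "computable n a \<Longrightarrow> computable n b \<Longrightarrow> ?thesis" by (rule computable_comp2)
qed

lemma computable_sum [computable_intros]:
  assumes "computable n b" "computable (Suc n) (\<lambda>e. f (e 0) (\<lambda>j. e (Suc j)))"
  shows "computable n (\<lambda>e. \<Sum>i<b e. f i e)"
proof -
  have "rec_nat 0 (\<lambda>i r. r + f i e) y = (\<Sum>i<y. f i e)" for y e by (induction y) auto
  moreover have "computable n (\<lambda>e. rec_nat 0 (\<lambda>i r. r + f i e) (b e))"
  proof (rule computable_intros assms)+
    show "computable (Suc (Suc n)) (\<lambda>e. f (e 1) (\<lambda>j. e (Suc (Suc j))))"
      using computable_comp[OF assms(2), of "Suc (Suc n)" "\<lambda>i e. e (Suc i)"] by (simp add: computable_var)
  qed simp
  ultimately show ?thesis by simp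
qed

lemma computable_of_bool [computable_intros]: "decidable n P \<Longrightarrow> computable n (\<lambda>e. of_bool (P e))"
  by (simp add: decidable_def)

lemma decidable_not [computable_intros]: "decidable n P \<Longrightarrow> decidable n (\<lambda>e. \<not> P e)"
proof -
  assume "decidable n P"
  then have "computable n (\<lambda>e. 1 - of_bool (P e))" by (intro computable_intros)
  also have "(\<lambda>e. 1 - of_bool (P e)) = (\<lambda>e. of_bool (\<not> P e) :: nat)" by auto
  finally show ?thesis by (simp add: decidable_def)
qed

lemma decidable_conj [computable_intros]: "decidable n P \<Longrightarrow> decidable n Q \<Longrightarrow> decidable n (\<lambda>e. P e \<and> Q e)"
proof -
  assume "decidable n P" "decidable n Q"
  then have "computable n (\<lambda>e. of_bool (P e) * of_bool (Q e))" by (intro computable_intros)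
  also have "(\<lambda>e. of_bool (P e) * of_bool (Q e)) = (\<lambda>e. of_bool (P e \<and> Q e) :: nat)" by auto
  finally show ?thesis by (simp add: decidable_def)
qed

lemma decidable_imp [computable_intros]: "decidable n P \<Longrightarrow> decidable n Q \<Longrightarrow> decidable n (\<lambda>e. P e \<longrightarrow> Q e)"
  using decidable_not[OF decidable_conj[of n P "\<lambda>e. \<not> Q e"]] decidable_not[of n Q] by simp

lemma decidable_disj [computable_intros]: "decidable n P \<Longrightarrow> decidable n Q \<Longrightarrow> decidable n (\<lambda>e. P e \<or> Q e)"
  using decidable_imp[of n "\<lambda>e. \<not> P e" Q] decidable_not[of n P] by (simp add: disj_imp)

lemma decidable_le [computable_intros]: "computable n a \<Longrightarrow> computable n b \<Longrightarrow> decidable n (\<lambda>e. a e \<le> b e)"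
proof -
  assume "computable n a" "computable n b"
  then have "computable n (\<lambda>e. 1 - (a e - b e))" by (intro computable_intros)
  also have "(\<lambda>e. 1 - (a e - b e)) = (\<lambda>e. of_bool (a e \<le> b e) :: nat)" by auto
  finally show ?thesis by (simp add: decidable_def)
qed

lemma decidable_less [computable_intros]: "computable n a \<Longrightarrow> computable n b \<Longrightarrow> decidable n (\<lambda>e. a e < b e)"
  using decidable_le[of n "\<lambda>e. Suc (a e)" b] computable_Suc[of n a] by (simp add: Suc_le_eq)

lemma decidable_eq [computable_intros]: "computable n a \<Longrightarrow> computable n b \<Longrightarrow> decidable n (\<lambda>e. a e = b e)"
  using decidable_conj[OF decidable_le[of n a b] decidable_le[of n b a]] by (simp add: eq_iff)

lemma decidable_bex [computable_intros]:
  assumes "computable n b" "decidable (Suc n) (\<lambda>e. P (e 0) (\<lambda>j. e (Suc j)))"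
  shows "decidable n (\<lambda>e. \<exists>i<b e. P i e)"
proof -
  have "decidable n (\<lambda>e. 0 < (\<Sum>i<b e. of_bool (P i e) :: nat))" by (rule computable_intros assms)+
  also have "(\<lambda>e. 0 < (\<Sum>i<b e. of_bool (P i e) :: nat)) = (\<lambda>e. \<exists>i<b e. P i e)"
    by (auto simp: fun_eq_iff card_gt_0_iff)
  finally show ?thesis .
qed

lemma decidable_ball [computable_intros]:
  assumes "computable n b" "decidable (Suc n) (\<lambda>e. P (e 0) (\<lambda>j. e (Suc j)))"
  shows "decidable n (\<lambda>e. \<forall>i<b e. P i e)"
  using decidable_not[OF decidable_bex[OF assms(1) decidable_not[OF assms(2)]]] by simp

lemma computable_div [computable_intros]:
  assumes "computable n a" "computable n b" shows "computable n (\<lambda>e. a e div b e)"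
proof -
  \<comment> \<open>The disjunct \<open>y = 0\<close> makes the search total and returns 0, in
    agreement with division by zero.\<close>
  have e: "(LEAST z. y = 0 \<or> x < y * Suc z) = x div y" for x y :: nat
  proof (cases "y = 0")
    case False
    show ?thesis
    proof (rule Least_equality)
      show "y = 0 \<or> x < y * Suc (x div y)" using False dividend_less_times_div[of y x] by simp
      show "x div y \<le> z" if "y = 0 \<or> x < y * Suc z" for z
        using that False by (metis less_Suc_eq_le less_mult_imp_div_less mult.commute)
    qed
  qed simp
  have "computable 2 (\<lambda>e. LEAST z. e 1 = 0 \<or> e 0 < e 1 * Suc z)"
  proof (rule computable_mu)
    show "\<exists>z. e 1 = 0 \<or> e 0 < e 1 * Suc z" for e :: "nat \<Rightarrow> nat"
      by (rule exI[of _ "e 0"]) (cases "e 1"; simp)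
  qed (rule computable_intros | simp)+
  then have "computable 2 (\<lambda>e. e 0 div e 1)" by (simp only: e)
  from computable_comp2[OF this assms] show ?thesis .
qed

lemma computable_mod [computable_intros]:
  assumes "computable n a" "computable n b" shows "computable n (\<lambda>e. a e mod b e)"
proof -
  have "computable n (\<lambda>e. a e - b e * (a e div b e))" by (rule computable_intros assms)+
  then show ?thesis by (simp add: minus_mult_div_eq_mod)
qed

lemma computable_if [computable_intros]:
  assumes "decidable n P" "computable n a" "computable n b" shows "computable n (\<lambda>e. if P e then a e else b e)"
proof -
  have "computable n (\<lambda>e. of_bool (P e) * a e + of_bool (\<not> P e) * b e)" by (rule computable_intros assms)+
  also have "(\<lambda>e. of_bool (P e) * a e + of_bool (\<not> P e) * b e) = (\<lambda>e. if P e then a e else b e)" by auto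
  finally show ?thesis .
qed

lemma computable_prod_encode [computable_intros]: "computable n a \<Longrightarrow> computable n b \<Longrightarrow> computable n (\<lambda>e. prod_encode (a e, b e))"
  unfolding prod_encode_def triangle_def by (simp, (rule computable_intros | assumption)+)

lemma prod_encode_bounds: "x \<le> prod_encode (x, y)" "y \<le> prod_encode (x, y)"
  by (rule le_prod_encode_1 le_prod_encode_2)+

text \<open>The code dominates both components, so the other component is found by a bounded search
  and the condition under the minimum is decidable.\<close>

lemma computable_fst_decode [computable_intros]:
  assumes "computable n a" shows "computable n (\<lambda>e. fst (prod_decode (a e)))"
proof -
  have e: "(LEAST z. \<exists>y<Suc k. prod_encode (z, y) = k) = fst (prod_decode k)" for k
  proof (rule Least_equality)
    show "\<exists>y<Suc k. prod_encode (fst (prod_decode k), y) = k"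
      using prod_encode_bounds(2)[of "snd (prod_decode k)" "fst (prod_decode k)"]
      by (intro exI[of _ "snd (prod_decode k)"]) simp
  qed auto
  have "computable 1 (\<lambda>e. LEAST z. \<exists>y<Suc (e 0). prod_encode (z, y) = e 0)"
  proof (rule computable_mu)
    show "\<exists>z. \<exists>y<Suc (e 0). prod_encode (z, y) = e 0" for e :: "nat \<Rightarrow> nat"
      using prod_encode_bounds(2)[of "snd (prod_decode (e 0))" "fst (prod_decode (e 0))"]
      by (intro exI[of _ "fst (prod_decode (e 0))"] exI[of _ "snd (prod_decode (e 0))"]) simp
  qed (rule computable_intros | simp)+
  then have "computable 1 (\<lambda>e. fst (prod_decode (e 0)))" by (simp only: e)
  from computable_comp1[OF this assms] show ?thesis .
qed

lemma computable_snd_decode [computable_intros]: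
  assumes "computable n a" shows "computable n (\<lambda>e. snd (prod_decode (a e)))"
proof -
  have e: "(LEAST z. \<exists>y<Suc k. prod_encode (y, z) = k) = snd (prod_decode k)" for k
  proof (rule Least_equality)
    show "\<exists>y<Suc k. prod_encode (y, snd (prod_decode k)) = k"
      using prod_encode_bounds(1)[of "fst (prod_decode k)" "snd (prod_decode k)"]
      by (intro exI[of _ "fst (prod_decode k)"]) simp
  qed auto
  have "computable 1 (\<lambda>e. LEAST z. \<exists>y<Suc (e 0). prod_encode (y, z) = e 0)"
  proof (rule computable_mu)
    show "\<exists>z. \<exists>y<Suc (e 0). prod_encode (y, z) = e 0" for e :: "nat \<Rightarrow> nat"
      using prod_encode_bounds(1)[of "fst (prod_decode (e 0))" "snd (prod_decode (e 0))"]
      by (intro exI[of _ "snd (prod_decode (e 0))"] exI[of _ "fst (prod_decode (e 0))"]) simp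
  qed (rule computable_intros | simp)+
  then have "computable 1 (\<lambda>e. snd (prod_decode (e 0)))" by (simp only: e)
  from computable_comp1[OF this assms] show ?thesis .
qed

section \<open>Computability of the clocked evaluator\<close>

lemma decidable_exists_zero:
  assumes "\<And>g. g \<in> set gs \<Longrightarrow> computable n (h g)"
  shows "decidable n (\<lambda>e. 0 \<in> set (map (\<lambda>g. h g e) gs))"
  using assms
proof (induction gs)
  case Nil
  have "decidable n (\<lambda>e. 0 < (0::nat))" by (rule computable_intros)+
  then show ?case by simp
next
  case (Cons g gs)
  have "decidable n (\<lambda>e. 0 = h g e \<or> 0 \<in> set (map (\<lambda>g. h g e) gs))"
    by (intro computable_intros Cons) (use Cons in auto)
  then show ?case by simp
qed

text \<open>Induction on the fixed program \<open>F\<close>, for all arities at once; no universal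
  function is built. The clause for \<open>Mn\<close> is total because the bound \<open>e 0\<close>
  ends its search.\<close>

lemma computable_clocked: "computable (Suc n) (\<lambda>e. clocked F (e 0) (map (\<lambda>j. e (Suc j)) [0..<n]))"
proof (induction F arbitrary: n)
  case Zero
  show ?case by (simp add: computable_const del: One_nat_def)
next
  case Succ
  have "computable (Suc (Suc k)) (\<lambda>e. Suc (Suc (e (Suc 0))))" for k by (intro computable_intros) simp
  then show ?case by (cases n) (auto simp: map_upt_shift computable_const simp del: upt_Suc)
next
  case (Proj i)
  have "computable (Suc n) (\<lambda>e. Suc (e (Suc i)))" if "i < n" using that by (intro computable_intros) simp
  then show ?case by (cases "i < n") (auto simp: computable_const)
next
  case (Comp f gs)
  let ?a = "\<lambda>g e. clocked g (e 0) (map (\<lambda>j. e (Suc j)) [0..<n])"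
  define k where "k = length gs"
  have a: "computable (Suc n) (\<lambda>e. ?a (gs ! i) e - 1)" if "i < k" for i
    by (intro computable_intros Comp.IH(2)) (use that in \<open>auto simp: k_def\<close>)
  let ?c = "\<lambda>i. case i of 0 \<Rightarrow> (\<lambda>e. e 0) | Suc j \<Rightarrow> (\<lambda>e. ?a (gs ! j) e - 1)"
    have "computable (Suc n) (?c i)" if "i < Suc k" for i
    using that a by (auto split: nat.splits intro: computable_var)
  from computable_comp[where a="?c", OF Comp.IH(1)[of k] this]
  have 1: "computable (Suc n) (\<lambda>e. clocked f (e 0) (map (\<lambda>j. ?a (gs ! j) e - 1) [0..<k]))" by simp
  have 2: "decidable (Suc n) (\<lambda>e. 0 \<in> set (map (\<lambda>g. ?a g e) gs))"
    by (rule decidable_exists_zero) (rule Comp.IH(2))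
  have "map (\<lambda>j. ?a (gs ! j) e - 1) [0..<k] = map (\<lambda>g. ?a g e - 1) gs" for e
    by (rule nth_equalityI) (auto simp: k_def)
  then have "clocked (Comp f gs) (e 0) (map (\<lambda>j. e (Suc j)) [0..<n]) =
      (if 0 \<in> set (map (\<lambda>g. ?a g e) gs) then 0 else clocked f (e 0) (map (\<lambda>j. ?a (gs ! j) e - 1) [0..<k]))" for e
    by (simp add: Let_def o_def)
  with computable_if[OF 2 computable_const[of _ 0] 1] show ?case by presburger
next
  case (Prim f g)
  show ?case
  proof (cases n)
    case 0
    then show ?thesis by (simp add: computable_const)
  next
    case (Suc k)
    let ?m = "\<lambda>e. map (\<lambda>j. e (Suc (Suc j))) [0..<k]"
    let ?c = "\<lambda>i. case i of 0 \<Rightarrow> (\<lambda>e. e 0) | Suc j \<Rightarrow> (\<lambda>e. e (Suc (Suc j)))"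
    have "computable (Suc n) (?c i)" if "i < Suc k" for i
      using that by (auto simp: Suc split: nat.splits intro: computable_var)
    from computable_comp[where a="?c", OF Prim.IH(1)[of k] this]
    have f: "computable (Suc n) (\<lambda>e. clocked f (e 0) (?m e))" by simp
    \<comment> \<open>Here \<open>e 0\<close> is the previous value, \<open>e 1\<close> the counter,
      \<open>e 2\<close> the clock and \<open>e 3\<close> the recursion count. The last is dropped,
      hence the shift by four for the parameters.\<close>
    let ?c = "\<lambda>i. case i of 0 \<Rightarrow> (\<lambda>e. e 2) | Suc 0 \<Rightarrow> (\<lambda>e. e 0 - 1) | Suc (Suc 0) \<Rightarrow> (\<lambda>e. e 1) |
        Suc (Suc (Suc j)) \<Rightarrow> (\<lambda>e. e (Suc (Suc (Suc (Suc j)))))"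
    have "computable (Suc (Suc (Suc n))) (?c i)" if "i < Suc (Suc (Suc k))" for i
      using that by (auto simp: Suc split: nat.splits intro: computable_intros)
    from computable_comp[where a="?c", OF Prim.IH(2)[of "Suc (Suc k)"] this]
    have g: "computable (Suc (Suc (Suc n))) (\<lambda>e. clocked g (e 2) ((e 0 - 1) # e 1 # map (\<lambda>j. e (Suc (Suc (Suc (Suc j))))) [0..<k]))"
      by (simp add: map_upt_shift del: upt_Suc)
    have "computable (Suc n) (\<lambda>e. rec_nat (clocked f (e 0) (?m e))
        (\<lambda>i r. if r = 0 then 0 else clocked g (e 0) ((r - 1) # i # ?m e)) (e 1))"
    proof (rule computable_prim[OF _ f])
      show "computable (Suc (Suc (Suc n))) (\<lambda>e. if e 0 = 0 then 0 else clocked g (e (Suc (Suc 0))) ((e 0 - 1) # e 1 #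
          map (\<lambda>j. e (Suc (Suc (Suc (Suc j))))) [0..<k]))"
        by (intro computable_intros) (use g in \<open>simp_all add: numeral_2_eq_2\<close>)
    qed (simp add: Suc computable_var)
    then show ?thesis by (simp add: Suc map_upt_shift del: upt_Suc)
  qed
next
  case (Mn f)
  let ?x = "\<lambda>e. map (\<lambda>j. e (Suc j)) [0..<n]"
  let ?z = "\<lambda>e. LEAST z. e 0 \<le> z \<or> clocked f (e 0) (z # ?x e) \<le> 1"
  let ?c = "\<lambda>i. case i of 0 \<Rightarrow> (\<lambda>e. e 1) | Suc 0 \<Rightarrow> (\<lambda>e. e 0) |
        Suc (Suc j) \<Rightarrow> (\<lambda>e. e (Suc (Suc j)))"
    have "computable (Suc (Suc n)) (?c i)" if "i < Suc (Suc n)" for i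
      using that by (auto split: nat.splits intro: computable_intros)
  from computable_comp[where a="?c", OF Mn.IH[of "Suc n"] this]
  have f: "computable (Suc (Suc n)) (\<lambda>e. clocked f (e (Suc 0)) (e 0 # map (\<lambda>j. e (Suc (Suc j))) [0..<n]))"
    by (simp add: map_upt_shift del: upt_Suc)
  have z: "computable (Suc n) ?z"
  proof (rule computable_mu)
    show "\<exists>z. e 0 \<le> z \<or> clocked f (e 0) (z # ?x e) \<le> 1" for e :: "nat \<Rightarrow> nat" by auto
    show "decidable (Suc (Suc n)) (\<lambda>e. e (Suc 0) \<le> e 0 \<or> clocked f (e (Suc 0)) (e 0 # map (\<lambda>j. e (Suc (Suc j))) [0..<n]) \<le> 1)"
      by (intro computable_intros f) auto
  qed
  let ?c = "\<lambda>i. case i of 0 \<Rightarrow> ?z | Suc i \<Rightarrow> (\<lambda>e. e i)"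
    have "computable (Suc n) (?c i)" if "i < Suc (Suc n)" for i
    using that z by (auto split: nat.splits intro: computable_var)
  from computable_comp[where a="?c", OF f this]
  have 1: "computable (Suc n) (\<lambda>e. clocked f (e 0) (?z e # ?x e))" by simp
  have "computable (Suc n) (\<lambda>e. if ?z e < e 0 \<and> clocked f (e 0) (?z e # ?x e) = 1 then Suc (?z e) else 0)"
    by (intro computable_intros z 1) auto
  then show ?case by (simp only: clocked.simps Let_def)
qed

lemma computable_clocked2 [computable_intros]:
  assumes "computable n t" "computable n a" "computable n b" shows "computable n (\<lambda>e. clocked F (t e) [a e, b e])"
proof -
  have "computable 3 (\<lambda>e. clocked F (e 0) [e 1, e 2])" using computable_clocked[of 2 F] by (simp add: numeral_eq_Suc)
  from computable_comp3[OF this assms] show ?thesis .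
qed

section \<open>Numerical codes of strings\<close>

text \<open>In binary, \<open>enc xs + 1\<close> consists of the bits of \<open>xs\<close>, least
  significant first, below a leading 1.\<close>

lemma enc_length: "2 ^ length xs \<le> enc xs + 1" "enc xs + 1 < 2 ^ (length xs + 1)"
  by (induction xs) auto

lemma enc_inj: "enc xs = enc ys \<Longrightarrow> xs = ys"
proof (induction xs arbitrary: ys)
  case Nil
  then show ?case by (cases ys) (auto split: if_splits)
next
  case (Cons b xs)
  then obtain b' zs where ys: "ys = b' # zs" by (cases ys) (auto split: if_splits)
  from Cons.prems have "even (enc (b # xs)) = even (enc (b' # zs))" unfolding ys by simp
  then have "b = b'" by (auto split: if_splits)
  with Cons show ?case unfolding ys by auto
qed

lemma enc_surj: "\<exists>xs. enc xs = n"
proof (induction n rule: less_induct)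
  case (less n)
  show ?case
  proof (cases n)
    case 0
    then show ?thesis by (intro exI[of _ "[]"]) simp
  next
    case (Suc k)
    then obtain xs where "enc xs = k div 2" using less[of "k div 2"] by fastforce
    then show ?thesis unfolding Suc by (intro exI[of _ "odd k # xs"]) (auto elim!: oddE)
  qed
qed

definition decode :: "nat \<Rightarrow> bstr" where "decode = inv enc"

lemma enc_dec [simp]: "enc (decode n) = n"
  unfolding decode_def using enc_surj by (metis f_inv_into_f rangeI)

lemma length_le_iff: "length xs \<le> n \<longleftrightarrow> enc xs + 1 < 2 ^ (n + 1)"
proof
  assume "length xs \<le> n"
  then have "2 ^ (length xs + 1) \<le> (2::nat) ^ (n + 1)" by (intro power_increasing) auto
  then show "enc xs + 1 < 2 ^ (n + 1)" using enc_length(2)[of xs] by linarith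
next
  assume "enc xs + 1 < 2 ^ (n + 1)"
  then have "2 ^ length xs < (2::nat) ^ (n + 1)" using enc_length(1)[of xs] by linarith
  then show "length xs \<le> n" using power_less_imp_less_exp[of "2::nat" "length xs" "n + 1"] by simp
qed

lemma length_eqI: "2 ^ n \<le> enc xs + 1 \<Longrightarrow> enc xs + 1 < 2 ^ (n + 1) \<Longrightarrow> length xs = n"
  using length_le_iff[of xs n] length_le_iff[of xs "n - 1"] by (cases n) auto

lemma Least_length: "(LEAST n. enc xs + 1 < 2 ^ (n + 1)) = length xs"
  by (rule Least_equality) (use length_le_iff[of xs] in auto)

text \<open>The arithmetic counterpart of \<open>pair_str\<close>. The least \<open>n\<close> is the
  length of the first string, \<open>3 * (1 + bit)\<close> is the code of a doubled bit, and
  \<open>5 + 4 * f\<close> is the code of the separator followed by the second string.\<close>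

definition pair_code :: "nat \<Rightarrow> nat \<Rightarrow> nat" where
  "pair_code a f = (let n = LEAST n. a + 1 < 2 ^ (n + 1)
     in (\<Sum>i<n. 4 ^ i * (3 * (1 + ((a + 1) div 2 ^ i) mod 2))) + 4 ^ n * (5 + 4 * f))"

lemma computable_pair_code [computable_intros]: assumes "computable n a" "computable n b" shows "computable n (\<lambda>e. pair_code (a e) (b e))"
proof -
  have l: "computable 1 (\<lambda>e. LEAST n. e 0 + 1 < 2 ^ (n + 1))"
  proof (rule computable_mu)
    show "\<exists>n. e 0 + 1 < 2 ^ (n + 1)" for e :: "nat \<Rightarrow> nat"
      using less_exp[of "e 0 + 1"] less_trans[OF _ power_strict_increasing]
      by (metis add_lessD1 less_add_one one_less_numeral_iff semiring_norm(76))
  qed (rule computable_intros | simp)+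
  have "computable 2 (\<lambda>e. pair_code (e 0) (e 1))"
    unfolding pair_code_def Let_def by (rule computable_intros computable_comp1[OF l] | simp)+
  from computable_comp2[OF this assms] show ?thesis .
qed

lemma enc_append: "enc (xs @ ys) = enc xs + 2 ^ length xs * enc ys"
  by (induction xs) (auto simp: algebra_simps)

lemma length_doubled: "length (concat (map (\<lambda>b. [b, b]) a)) = 2 * length a"
  by (induction a) auto

lemma enc_doubled:
  "enc (concat (map (\<lambda>b. [b, b]) a)) = (\<Sum>i<length a. 4 ^ i * (3 * (1 + ((enc a + 1) div 2 ^ i) mod 2)))"
proof (induction a)
  case (Cons b a)
  have d: "(enc (b # a) + 1) div 2 ^ Suc i = (enc a + 1) div 2 ^ i" for i
    by (simp add: div_mult2_eq)
  have "(\<Sum>i<length (b # a). 4 ^ i * (3 * (1 + ((enc (b # a) + 1) div 2 ^ i) mod 2))) =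
     3 * (1 + of_bool b) + 4 * (\<Sum>i<length a. 4 ^ i * (3 * (1 + ((enc a + 1) div 2 ^ i) mod 2)))"
    unfolding list.size add_Suc_right add_0_right sum.lessThan_Suc_shift d
    by (simp add: sum_distrib_left mult.assoc del: One_nat_def)
  also have "\<dots> = enc (concat (map (\<lambda>b. [b, b]) (b # a)))"
    unfolding Cons.IH[symmetric] by simp
  finally show ?case ..
qed simp

lemma pair_code_enc: "pair_code (enc a) (enc f) = enc (pair_str a f)"
proof -
  have "pair_code (enc a) (enc f) = enc (concat (map (\<lambda>b. [b, b]) a)) + 4 ^ length a * (5 + 4 * enc f)"
    unfolding pair_code_def Let_def Least_length enc_doubled ..
  also have "\<dots> = enc (pair_str a f)"
    unfolding pair_str_def enc_append[of "concat _"] length_doubled power_mult by (simp add: algebra_simps)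
  finally show ?thesis .
qed

text \<open>The separator is the first aligned block of two different bits, so it marks where the
  first component ends.\<close>

lemma pair_str_inj: "pair_str a f = pair_str a' f' \<Longrightarrow> a = a' \<and> f = f'"
proof (induction a arbitrary: a')
  case Nil
  then show ?case by (cases a') (auto simp: pair_str_def)
next
  case (Cons b a)
  show ?case
  proof (cases a')
    case Nil
    with Cons.prems show ?thesis by (auto simp: pair_str_def)
  next
    case (Cons c a'')
    with Cons.prems have "b = c" "pair_str a f = pair_str a'' f'" by (auto simp: pair_str_def)
    with Cons.IH[of a''] Cons show ?thesis by auto
  qed
qed

lemma length_pair_str: "length (pair_str a f) = 2 * length a + 2 + length f"
  by (simp add: pair_str_def length_doubled)

lemma pair_code_inj: "pair_code a f = pair_code a' f' \<Longrightarrow> a = a' \<and> f = f'"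
  using pair_code_enc[of "decode a" "decode f"] pair_code_enc[of "decode a'" "decode f'"] enc_inj pair_str_inj enc_dec by metis

text \<open>These bounds turn the search for the components of a pair into a bounded, hence
  decidable, one.\<close>

lemma pair_code_ge: "a \<le> pair_code a f" "f \<le> pair_code a f"
proof -
  have *: "enc a \<le> enc (concat (map (\<lambda>b. [b, b]) a))" for a by (induction a) auto
  have "enc a \<le> enc (pair_str a f)" for a f
    using *[of a] by (simp add: pair_str_def enc_append[of "concat _"])
  from this[of "decode a" "decode f"] show "a \<le> pair_code a f" using pair_code_enc[of "decode a" "decode f"] by simp
  have "enc f \<le> enc (xs @ f)" for xs f by (induction xs) auto
  from this[of "decode f" "concat (map (\<lambda>b. [b, b]) (decode a)) @ [False, True]"]
  show "f \<le> pair_code a f" using pair_code_enc[of "decode a" "decode f"] by (simp add: pair_str_def)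
qed

section \<open>Complexity bounds from enumerations\<close>

lemma KS_le: "U p y = Some x \<Longrightarrow> KS U x y \<le> length p"
  unfolding KS_def by (rule Least_le) blast

lemma computable_dec_of_eval: "\<exists>D. \<forall>p y z. D p y = Some z \<longleftrightarrow> eval F [enc p, enc y] (enc z)"
proof (intro exI allI)
  let ?D = "\<lambda>p y. if \<exists>z. eval F [enc p, enc y] (enc z) then Some (THE z. eval F [enc p, enc y] (enc z)) else None"
  fix p y z
  have "(THE z. eval F [enc p, enc y] (enc z)) = z" if "eval F [enc p, enc y] (enc z)" for z
    using that enc_inj eval_det by blast
  then show "?D p y = Some z \<longleftrightarrow> eval F [enc p, enc y] (enc z)" by auto
qed

text \<open>Optimality is applied to the partial decompressor that outputs \<open>h\<close> of the
  first \<open>z\<close> accepted by \<open>Q\<close>. Existence of a program is recorded too, since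
  \<open>KS\<close> is a \<open>LEAST\<close> and says nothing about an empty set of
  programs.\<close>

lemma KS_search:
  assumes U: "optimal_dec U" and Q: "decidable 3 (\<lambda>e. Q (e 0) (e 1) (e 2))" and h: "computable 1 (\<lambda>e. h (e 0))"
  shows "\<exists>C. \<forall>p y x z. Q z (enc p) (enc y) \<longrightarrow> (\<forall>z'<z. \<not> Q z' (enc p) (enc y)) \<longrightarrow> h z = enc x \<longrightarrow>
     KS U x y \<le> length p + C \<and> (\<exists>q. U q y = Some x)"
proof -
  have "computable 3 (\<lambda>e. 1 - of_bool (Q (e 0) (e 1) (e 2)))" by (rule computable_intros Q)+
  then obtain F where F: "\<And>e. eval F (map e [0..<3]) (1 - of_bool (Q (e 0) (e 1) (e 2)))"
    unfolding computable_def by blast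
  have F': "eval F [z, p, y] (1 - of_bool (Q z p y))" for z p y
    using F[of "\<lambda>i. [z, p, y] ! i"] by (simp add: numeral_3_eq_3 numeral_2_eq_2)
  obtain H where H: "\<And>e. eval H (map e [0..<1]) (h (e 0))" using h unfolding computable_def by blast
  have H': "eval H [z] (h z)" for z using H[of "\<lambda>_. z"] by simp
  have ev: "eval (Comp H [Mn F]) [p, y] (h z)" if "Q z p y" "\<forall>z'<z. \<not> Q z' p y" for z p y
  proof (rule eval_evals.intros(4)[OF _ H'])
    have "eval (Mn F) [p, y] z"
    proof (rule eval_evals.intros(7))
      show "eval F (z # [p, y]) 0" using F'[of z p y] that by simp
      show "\<forall>m<z. \<exists>v. eval F (m # [p, y]) v \<and> v \<noteq> 0"
        using F'[of _ p y] that(2) by (metis diff_zero of_bool_eq(1) one_neq_zero)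
    qed
    then show "evals [Mn F] [p, y] [z]" by (intro eval_evals.intros(8,9))
  qed
  obtain D where D: "\<And>p y z. D p y = Some z \<longleftrightarrow> eval (Comp H [Mn F]) [enc p, enc y] (enc z)"
    using computable_dec_of_eval by metis
  then have "computable_dec D" unfolding computable_dec_def by blast
  then obtain C where C: "\<And>p y x. D p y = Some x \<Longrightarrow> (\<exists>q. U q y = Some x \<and> length q \<le> length p + C)"
    using U unfolding optimal_dec_def by blast
  show ?thesis
  proof (intro exI[of _ C] allI impI)
    fix p y x z assume "Q z (enc p) (enc y)" "\<forall>z'<z. \<not> Q z' (enc p) (enc y)" "h z = enc x"
    then have "D p y = Some x" using ev[of z "enc p" "enc y"] D by simp
    then obtain q where "U q y = Some x" "length q \<le> length p + C" using C by blast
    then show "KS U x y \<le> length p + C \<and> (\<exists>q. U q y = Some x)" using KS_le[of U q y x] by auto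
  qed
qed

text \<open>Programs are \<open>pair_str S B\<close>, where \<open>S\<close> codes \<open>(k, w)\<close> and the code of \<open>B\<close> is \<open>i + 2 ^ k * q\<close>
  for the position \<open>i < 2 ^ k\<close> of \<open>x\<close> in the enumeration.\<close>

lemma KS_enum:
  assumes U: "optimal_dec U" and R: "decidable 5 (\<lambda>e. R (e 0) (e 1) (e 2) (e 3) (e 4))"
  shows "\<exists>C. \<forall>k w q y x X. finite X \<longrightarrow> card X \<le> 2 ^ k \<longrightarrow>
      (\<forall>s x'. R s w (enc q) (enc y) x' \<longrightarrow> x' \<in> X) \<longrightarrow> (\<exists>s. R s w (enc q) (enc y) (enc x)) \<longrightarrow>
     KS U x y \<le> k + length q + 2 * length (decode (prod_encode (k, w))) + C \<and> (\<exists>p. U p y = Some x)"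
proof -
  \<comment> \<open>A number \<open>z\<close> codes a stage together with a candidate. The predicate
    \<open>new\<close> keeps the first appearance of each candidate, so counting new numbers counts
    distinct outputs.\<close>
  define hit where "hit z w q y \<longleftrightarrow> R (fst (prod_decode z)) w q y (snd (prod_decode z))" for z w q y
  define new where "new z w q y \<longleftrightarrow> hit z w q y \<and>
    (\<forall>z'<z. hit z' w q y \<longrightarrow> snd (prod_decode z') \<noteq> snd (prod_decode z))" for z w q y
  define Q where "Q z v y \<longleftrightarrow> (\<exists>S<Suc v. \<exists>B<Suc v. pair_code S B = v \<and>
    new z (snd (prod_decode S)) (B div 2 ^ fst (prod_decode S)) y \<and>
    (\<Sum>z'<z. of_bool (new z' (snd (prod_decode S)) (B div 2 ^ fst (prod_decode S)) y)) = B mod 2 ^ fst (prod_decode S))" for z v y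
  have R': "decidable n (\<lambda>e. R (a e) (b e) (c e) (d e) (f e))"
    if "computable n a" "computable n b" "computable n c" "computable n d" "computable n f" for n a b c d f
  proof -
    have "computable n ([a, b, c, d, f] ! i)" if "i < 5" for i
      using \<open>computable n a\<close> \<open>computable n b\<close> \<open>computable n c\<close> \<open>computable n d\<close> \<open>computable n f\<close> that by (auto simp: numeral_eq_Suc less_Suc_eq)
    from computable_comp[where a = "\<lambda>i. [a, b, c, d, f] ! i", OF R[unfolded decidable_def] this]
    show ?thesis unfolding decidable_def by simp
  qed
  have "decidable 4 (\<lambda>e. new (e 0) (e 1) (e 2) (e 3))"
    unfolding new_def hit_def by (rule computable_intros R' | simp)+
  then have new': "decidable n (\<lambda>e. new (a e) (b e) (c e) (d e))"
     if "computable n a" "computable n b" "computable n c" "computable n d" for n a b c d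
    using computable_comp4[of "\<lambda>a b c d. of_bool (new a b c d)" n a b c d] that unfolding decidable_def by blast
  have Q': "decidable 3 (\<lambda>e. Q (e 0) (e 1) (e 2))"
    unfolding Q_def by (rule computable_intros new' | simp)+
  have h: "computable 1 (\<lambda>e. snd (prod_decode (e 0)))" by (rule computable_intros | simp)+
  obtain C where C: "\<And>p y x z. Q z (enc p) (enc y) \<Longrightarrow> (\<forall>z'<z. \<not> Q z' (enc p) (enc y)) \<Longrightarrow>
       snd (prod_decode z) = enc x \<Longrightarrow> KS U x y \<le> length p + C \<and> (\<exists>q. U q y = Some x)"
    using KS_search[OF U Q' h] by blast
  show ?thesis
  proof (intro exI[of _ "C + 2"] allI impI)
    fix k w q y x X
    assume X: "finite X" "card X \<le> 2 ^ k" "\<forall>s x'. R s w (enc q) (enc y) x' \<longrightarrow> x' \<in> X"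
      and x: "\<exists>s. R s w (enc q) (enc y) (enc x)"
    define N where "N z \<longleftrightarrow> new z w (enc q) (enc y)" for z
    define H where "H z \<longleftrightarrow> hit z w (enc q) (enc y)" for z
    have N: "N z \<longleftrightarrow> H z \<and> (\<forall>z'<z. H z' \<longrightarrow> snd (prod_decode z') \<noteq> snd (prod_decode z))" for z
      unfolding N_def H_def new_def ..
    obtain s where "R s w (enc q) (enc y) (enc x)" using x by blast
    then have "\<exists>z. H z \<and> snd (prod_decode z) = enc x"
      unfolding H_def hit_def by (intro exI[of _ "prod_encode (s, enc x)"]) simp
    then obtain z where z: "H z" "snd (prod_decode z) = enc x"
        "\<And>z'. z' < z \<Longrightarrow> \<not> (H z' \<and> snd (prod_decode z') = enc x)"
      using exists_least_iff[of "\<lambda>z. H z \<and> snd (prod_decode z) = enc x"] by blast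
    then have Nz: "N z" unfolding N by auto
    define cnt where "cnt z = (\<Sum>z'<z. of_bool (N z') :: nat)" for z
    have cnt: "cnt z = card {z'. z' < z \<and> N z'}" for z
      unfolding cnt_def by (simp add: Collect_conj_eq lessThan_def)
    have inj: "inj_on (\<lambda>z. snd (prod_decode z)) {z. N z}"
    proof (rule inj_onI)
      fix u v assume "u \<in> {z. N z}" "v \<in> {z. N z}" "snd (prod_decode u) = snd (prod_decode v)"
      then show "u = v" unfolding mem_Collect_eq N by (metis linorder_neqE_nat)
    qed
    \<comment> \<open>The first appearances up to and including \<open>z\<close> give distinct
      members of \<open>X\<close>, so the position of \<open>enc x\<close> fits into
      \<open>k\<close> bits.\<close>
    have "card ((\<lambda>z. snd (prod_decode z)) ` insert z {z'. z' < z \<and> N z'}) \<le> card X"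
      by (rule card_mono) (use X Nz in \<open>auto simp: N H_def hit_def\<close>)
    also have "card ((\<lambda>z. snd (prod_decode z)) ` insert z {z'. z' < z \<and> N z'}) =
        card (insert z {z'. z' < z \<and> N z'})"
      by (rule card_image, rule inj_on_subset[OF inj]) (use Nz in auto)
    also have "\<dots> = Suc (cnt z)" unfolding cnt by simp
    finally have lt: "cnt z < 2 ^ k" using X by simp
    define S where "S = prod_encode (k, w)"
    define B where "B = cnt z + 2 ^ k * enc q"
    have Bd: "B div 2 ^ k = enc q" "B mod 2 ^ k = cnt z" using lt by (auto simp: B_def)
    have Qi: "Q z' (pair_code S B) (enc y) \<longleftrightarrow> N z' \<and> cnt z' = cnt z" for z'
    proof -
      have "Q z' (pair_code S B) (enc y) \<longleftrightarrow> new z' w (enc q) (enc y) \<and> (\<Sum>z'<z'. of_bool (new z' w (enc q) (enc y))) = cnt z"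
        unfolding Q_def
      proof (safe, goal_cases)
        case (1 S' B')
        then have "S' = S" "B' = B" using pair_code_inj by blast+
        then show ?case using 1 by (simp add: S_def Bd)
      next
        case (2 S' B')
        then have "S' = S" "B' = B" using pair_code_inj by blast+
        then show ?case using 2 by (simp add: S_def Bd)
      next
        case 3
        then show ?case using pair_code_ge[of S B] pair_code_ge[of B S]
          by (intro exI[of _ S] exI[of _ B] conjI) (simp_all add: S_def Bd less_Suc_eq_le pair_code_ge)
      qed
      then show ?thesis unfolding N_def cnt_def .
    qed
    \<comment> \<open>The count increases strictly past a new number, so no earlier new number has
      the same position and the search stops at \<open>z\<close>.\<close>
    have less: "cnt u < cnt v" if "u < v" "N u" for u v
      unfolding cnt by (rule psubset_card_mono) (use that in auto)
    define p where "p = pair_str (decode S) (decode B)"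
    have p: "enc p = pair_code S B" unfolding p_def pair_code_enc[symmetric] by simp
    have "KS U x y \<le> length p + C \<and> (\<exists>q. U q y = Some x)"
    proof (rule C[of z p])
      show "Q z (enc p) (enc y)" unfolding p Qi using Nz by simp
      show "\<forall>z'<z. \<not> Q z' (enc p) (enc y)" unfolding p Qi using less[of _ z] by (metis nat_neq_iff)
    qed (rule z)
    \<comment> \<open>Position and \<open>q\<close> share the string \<open>B\<close>, so
      \<open>k\<close> and \<open>length q\<close> enter with coefficient one;
      \<open>pair_str\<close> doubles only \<open>S\<close>.\<close>
    moreover have "length (decode B) \<le> k + length q"
    proof -
      have "B + 1 \<le> 2 ^ k * (enc q + 1)" using lt by (simp add: B_def)
      also have "\<dots> < 2 ^ k * 2 ^ (length q + 1)" using enc_length(2)[of q]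
        by (intro mult_strict_left_mono) simp_all
      finally show ?thesis unfolding length_le_iff by (simp add: power_add)
    qed
    ultimately show "KS U x y \<le> k + length q + 2 * length (decode (prod_encode (k, w))) + (C + 2) \<and> (\<exists>p. U p y = Some x)"
      unfolding p_def length_pair_str S_def by auto
  qed
qed

section \<open>A hash table avoiding sparse sets\<close>

text \<open>Packs a finite table into one number in base \<open>M\<close>. Hash tables and, with
  base 2, subsets thus become numbers that a program can search through.\<close>

lemma digits_exist:
  assumes "\<And>i. i < n \<Longrightarrow> H i < (M::nat)"
  shows "\<exists>t<M ^ n. \<forall>i<n. t div M ^ i mod M = H i"
  using assms
proof (induction n arbitrary: H)
  case 0
  then show ?case by simp
next
  case (Suc n)
  obtain t where t: "t < M ^ n" "\<forall>i<n. t div M ^ i mod M = H (Suc i)"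
    using Suc.IH[of "\<lambda>i. H (Suc i)"] Suc.prems by auto
  have H0: "H 0 < M" using Suc.prems by simp
  show ?case
  proof (intro exI[of _ "H 0 + M * t"] conjI allI impI)
    have "H 0 + M * t < M * (t + 1)" using H0 by simp
    also have "\<dots> \<le> M * M ^ n" using t(1) by (intro mult_left_mono) auto
    finally show "H 0 + M * t < M ^ Suc n" by simp
    fix i assume "i < Suc n"
    then show "(H 0 + M * t) div M ^ i mod M = H i" using H0 t(2)
      by (cases i) (auto simp: div_mult2_eq)
  qed
qed

text \<open>Large enough that \<open>2 ^ num_seeds N m\<close> exceeds
  \<open>2 * (2 ^ (N + 1) * 2 ^ m)\<close>, which the union bound over tables requires.\<close>

definition num_seeds :: "nat \<Rightarrow> nat \<Rightarrow> nat" where "num_seeds N m = N + m + 3"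

text \<open>A digit of \<open>t\<close> in base \<open>2 ^ m\<close>. Rows have length
  \<open>2 ^ (N + 1)\<close> because the codes of all strings of length at most \<open>N\<close> lie
  below this number.\<close>

definition table_entry :: "nat \<Rightarrow> nat \<Rightarrow> nat \<Rightarrow> nat \<Rightarrow> nat \<Rightarrow> nat" where
  "table_entry t N m r x = t div (2 ^ m) ^ (r * 2 ^ (N + 1) + x) mod 2 ^ m"

text \<open>\<open>B\<close> is the bit mask of a subset of \<open>{..<2 ^ m}\<close>.\<close>

definition good_table :: "nat \<Rightarrow> nat \<Rightarrow> nat \<Rightarrow> bool" where
  "good_table N m t \<longleftrightarrow> (\<forall>B<(2::nat) ^ 2 ^ m. 2 * (\<Sum>i<2 ^ m. B div 2 ^ i mod 2) \<le> 2 ^ m \<longrightarrow>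
     (\<Sum>x<2 ^ (N + 1). of_bool (\<exists>p<2 ^ m. \<forall>r<num_seeds N m. B div 2 ^ ((p + table_entry t N m r x) mod 2 ^ m) mod 2 = 1)) < (2::nat) ^ m)"

lemma good_tableD:
  "good_table N m t \<Longrightarrow> B < (2::nat) ^ 2 ^ m \<Longrightarrow> 2 * (\<Sum>i<2 ^ m. B div 2 ^ i mod 2) \<le> 2 ^ m \<Longrightarrow>
     (\<Sum>x<2 ^ (N + 1). of_bool (\<exists>p<2 ^ m. \<forall>r<num_seeds N m. B div 2 ^ ((p + table_entry t N m r x) mod 2 ^ m) mod 2 = 1)) < (2::nat) ^ m"
  unfolding good_table_def by blast

lemma mod_add_left_cancel:
  fixes h h' M :: nat
  assumes "(p + h) mod M = (p + h') mod M" "h < M" "h' < M"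
  shows "h = h'"
proof -
  have *: "u = v" if "u \<le> v" "v < M" "(p + v) mod M = (p + u) mod M" for u v
  proof -
    have "M dvd (p + v) - (p + u)" by (rule mod_eq_dvd_iff_nat[THEN iffD1]) (use that in auto)
    then have "\<not> 0 < v - u" unfolding diff_cancel2 diff_add_inverse diff_diff_left[symmetric] using nat_dvd_not_less[of "v - u" M] less_imp_diff_less[OF that(2), of u] by blast
    then show ?thesis using that(1) by simp
  qed
  show ?thesis using *[of h h'] *[of h' h] assms by linarith
qed

lemma card_shift_le:
  assumes "Y \<subseteq> {..<M}"
  shows "card {h. h < M \<and> (p + h) mod M \<in> Y} \<le> card (Y :: nat set)"
proof (rule card_inj_on_le)
  show "inj_on (\<lambda>h. (p + h) mod M) {h. h < M \<and> (p + h) mod M \<in> Y}"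
    by (rule inj_onI, rule mod_add_left_cancel) simp_all
  show "finite Y" using assms finite_subset by blast
qed auto

text \<open>A union bound in counting form. A failing table comes with a set \<open>Y\<close> and a
  list of \<open>M\<close> distinct inputs with offsets. For fixed \<open>Y\<close> and list,
  \<open>R * M\<close> entries are confined to at most half of their values, which leaves a fraction
  of at most \<open>1 / 2 ^ (R * M)\<close> of all tables. There are at most
  \<open>(2 * (A * M)) ^ M\<close> choices of \<open>Y\<close> and list, fewer than
  \<open>2 ^ (R * M)\<close>.\<close>

lemma table_exists:
  fixes A M R :: nat
  assumes "0 < M" "2 * (A * M) < 2 ^ R"
  shows "\<exists>H. (\<forall>r<R. \<forall>x<A. H r x < M) \<and> (\<forall>Y\<subseteq>{..<M}. 2 * card Y \<le> M \<longrightarrow>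
     card {x. x < A \<and> (\<exists>p<M. \<forall>r<R. (p + H r x) mod M \<in> Y)} < M)"
proof -
  define I where "I = {..<R} \<times> {..<A}"
  define \<Phi> where "\<Phi> = {\<phi> \<in> {..<M} \<rightarrow>\<^sub>E {..<A} \<times> {..<M}. inj_on (\<lambda>j. fst (\<phi> j)) {..<M}}"
  define \<Psi> where "\<Psi> = {Y. Y \<subseteq> {..<M} \<and> 2 * card Y \<le> M} \<times> \<Phi>"
  define bad where "bad = (\<lambda>(Y, \<phi>). {H \<in> I \<rightarrow>\<^sub>E {..<M}.
     \<forall>j<M. \<forall>r<R. (snd (\<phi> j) + H (r, fst (\<phi> j))) mod M \<in> Y})"
  have finI: "finite I" by (simp add: I_def)
  have bad_card: "2 ^ (R * M) * card (bad P) \<le> M ^ (R * A)" if "P \<in> \<Psi>" for P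
  proof -
    obtain Y \<phi> where P: "P = (Y, \<phi>)" by (cases P)
    have Y: "Y \<subseteq> {..<M}" "2 * card Y \<le> M" and \<phi>: "\<phi> \<in> {..<M} \<rightarrow>\<^sub>E {..<A} \<times> {..<M}" "inj_on (\<lambda>j. fst (\<phi> j)) {..<M}"
      using that by (auto simp: P \<Psi>_def \<Phi>_def)
    define T where "T = (\<lambda>j. fst (\<phi> j)) ` {..<M}"
    have T: "T \<subseteq> {..<A}" "card T = M"
      using \<phi> by (auto simp: T_def card_image PiE_def Pi_def)
    \<comment> \<open>The values still open to an entry of a table that is bad for \<open>Y\<close>
      and the list.\<close>
    define W where "W = (\<lambda>(r::nat, x). {h. h < M \<and> (\<forall>j<M. fst (\<phi> j) = x \<longrightarrow> (snd (\<phi> j) + h) mod M \<in> Y)})"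
    have "bad P \<subseteq> PiE I W"
    proof
      fix H assume "H \<in> bad P"
      then show "H \<in> PiE I W"
        unfolding bad_def P W_def I_def by (auto simp: PiE_iff)
    qed
    then have "card (bad P) \<le> card (PiE I W)"
      by (rule card_mono[rotated]) (auto intro!: finite_PiE finI simp: W_def)
    also have "\<dots> = (\<Prod>i\<in>I. card (W i))" by (rule card_PiE[OF finI])
    finally have c: "card (bad P) \<le> (\<Prod>i\<in>I. card (W i))" .
    have W: "2 ^ of_bool (snd i \<in> T) * card (W i) \<le> M" for i
    proof (cases "snd i \<in> T")
      case True
      then obtain j where j: "j < M" "fst (\<phi> j) = snd i" by (auto simp: T_def)
      have "W i \<subseteq> {h. h < M \<and> (snd (\<phi> j) + h) mod M \<in> Y}"
        using j by (auto simp: W_def split: prod.splits)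
      then have "card (W i) \<le> card {h. h < M \<and> (snd (\<phi> j) + h) mod M \<in> Y}"
        by (rule card_mono[rotated]) simp
      also have "\<dots> \<le> card Y" by (rule card_shift_le[OF Y(1)])
      finally show ?thesis using True Y(2) by simp
    next
      case False
      have "W i \<subseteq> {..<M}" by (auto simp: W_def split: prod.splits)
      from card_mono[OF _ this] False show ?thesis by simp
    qed
    \<comment> \<open>One entry is confined for each seed and each of the \<open>M\<close> listed
      inputs.\<close>
    have "(\<Sum>i\<in>I. of_bool (snd i \<in> T)) = (\<Sum>r<R. \<Sum>x<A. of_bool (x \<in> T) :: nat)"
      unfolding I_def sum.cartesian_product by (simp add: case_prod_unfold)
    also have "\<dots> = R * M" using T by (simp add: Int_absorb1 Int_absorb2)
    finally have "2 ^ (R * M) = (\<Prod>i\<in>I. 2 ^ of_bool (snd i \<in> T) :: nat)"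
      by (simp add: power_sum[symmetric])
    then have "2 ^ (R * M) * card (bad P) \<le> (\<Prod>i\<in>I. 2 ^ of_bool (snd i \<in> T)) * (\<Prod>i\<in>I. card (W i))"
      using c by simp
    also have "\<dots> = (\<Prod>i\<in>I. 2 ^ of_bool (snd i \<in> T) * card (W i))" by (simp add: prod.distrib)
    also have "\<dots> \<le> (\<Prod>i\<in>I. M)" by (rule prod_mono) (use W in auto)
    also have "\<dots> = M ^ (R * A)" by (simp add: I_def)
    finally show ?thesis .
  qed
  have fin\<Psi>: "finite \<Psi>" unfolding \<Psi>_def \<Phi>_def
    by (intro finite_SigmaI finite_subset[OF _ finite_Pow_iff[THEN iffD2], of _ "{..<M}"]
          finite_subset[OF _ finite_PiE, of _ "{..<M}" "\<lambda>_. {..<A} \<times> {..<M}"]) auto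
  have card\<Psi>: "card \<Psi> \<le> (2 * (A * M)) ^ M"
  proof -
    have "\<Psi> \<subseteq> Pow {..<M} \<times> ({..<M} \<rightarrow>\<^sub>E {..<A} \<times> {..<M})" by (auto simp: \<Psi>_def \<Phi>_def)
    then have "card \<Psi> \<le> card (Pow {..<M} \<times> ({..<M} \<rightarrow>\<^sub>E {..<A} \<times> {..<M}))"
      by (rule card_mono[rotated]) (auto intro!: finite_PiE)
    also have "\<dots> = (2 * (A * M)) ^ M"
      by (simp add: card_cartesian_product card_PiE card_Pow power_mult_distrib)
    finally show ?thesis .
  qed
  \<comment> \<open>The bad sets together are too small to cover all tables.\<close>
  have "\<not> (I \<rightarrow>\<^sub>E {..<M} \<subseteq> (\<Union>P\<in>\<Psi>. bad P))"
  proof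
    assume "I \<rightarrow>\<^sub>E {..<M} \<subseteq> (\<Union>P\<in>\<Psi>. bad P)"
    moreover have "finite (\<Union>P\<in>\<Psi>. bad P)"
      using fin\<Psi> by (intro finite_UN_I finite_subset[OF _ finite_PiE[of I "\<lambda>_. {..<M}"]]) (auto simp: bad_def finI)
    ultimately have "card (I \<rightarrow>\<^sub>E {..<M}) \<le> card (\<Union>P\<in>\<Psi>. bad P)" by (rule card_mono[rotated])
    also have "\<dots> \<le> (\<Sum>P\<in>\<Psi>. card (bad P))" by (rule card_UN_le[OF fin\<Psi>])
    finally have "2 ^ (R * M) * M ^ (R * A) \<le> 2 ^ (R * M) * (\<Sum>P\<in>\<Psi>. card (bad P))"
      by (subst (asm) card_PiE[OF finI]) (simp add: I_def)
    also have "\<dots> \<le> (\<Sum>P\<in>\<Psi>. M ^ (R * A))" unfolding sum_distrib_left by (intro sum_mono bad_card)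
    also have "\<dots> \<le> (2 * (A * M)) ^ M * M ^ (R * A)" using card\<Psi> by simp
    finally have "2 ^ (R * M) \<le> (2 * (A * M)) ^ M" using assms(1) by simp
    moreover have "(2 * (A * M)) ^ M < (2 ^ R) ^ M" using assms by (intro power_strict_mono) auto
    ultimately show False by (simp add: power_mult)
  qed
  then obtain H where H: "H \<in> I \<rightarrow>\<^sub>E {..<M}" "\<And>P. P \<in> \<Psi> \<Longrightarrow> H \<notin> bad P" by blast
  show ?thesis
  proof (intro exI[of _ "\<lambda>r x. H (r, x)"] conjI allI impI)
    fix r x assume "r < R" "x < A"
    then show "H (r, x) < M" using H(1) by (auto simp: I_def PiE_iff)
  next
    fix Y assume Y: "Y \<subseteq> {..<M}" "2 * card Y \<le> M"
    define X where "X = {x. x < A \<and> (\<exists>p<M. \<forall>r<R. (p + H (r, x)) mod M \<in> Y)}"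
    show "card {x. x < A \<and> (\<exists>p<M. \<forall>r<R. (p + H (r, x)) mod M \<in> Y)} < M"
      unfolding X_def[symmetric]
    proof (rule ccontr)
      \<comment> \<open>With \<open>M\<close> failing inputs one can list exactly \<open>M\<close>
        of them with offsets, and then \<open>H\<close> lies in one of the bad sets it was chosen to
        avoid.\<close>
      assume "\<not> card X < M"
      then obtain T where T: "T \<subseteq> X" "card T = M" "finite T"
        using obtain_subset_with_card_n[of M X] by (metis not_less)
      from ex_bij_betw_nat_finite[OF T(3)] T(2) obtain f where f: "bij_betw f {..<M} T"
        by (auto simp: atLeast0LessThan)
      have "\<forall>x\<in>X. \<exists>p<M. \<forall>r<R. (p + H (r, x)) mod M \<in> Y" by (auto simp: X_def)
      then obtain g where g: "\<And>x. x \<in> X \<Longrightarrow> g x < M" "\<And>x r. x \<in> X \<Longrightarrow> r < R \<Longrightarrow> (g x + H (r, x)) mod M \<in> Y"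
        by metis
      have fX: "f j \<in> X" if "j < M" for j using f T that by (auto simp: bij_betw_def)
      then have fA: "f j < A" if "j < M" for j using that by (auto simp: X_def)
      define \<phi> where "\<phi> = restrict (\<lambda>j. (f j, g (f j))) {..<M}"
      have "inj_on (\<lambda>j. fst (\<phi> j)) {..<M}" using f by (auto simp: \<phi>_def bij_betw_def inj_on_def)
      then have "(Y, \<phi>) \<in> \<Psi>" using Y fA g(1) fX by (auto simp: \<Psi>_def \<Phi>_def \<phi>_def)
      moreover have "H \<in> bad (Y, \<phi>)" using H(1) g(2) fX by (auto simp: bad_def \<phi>_def)
      ultimately show False using H(2) by blast
    qed
  qed
qed

lemma num_seeds_large: "2 * (2 ^ (N + 1) * 2 ^ m) < (2::nat) ^ num_seeds N m"
proof -
  have "2 * (2 ^ (N + 1) * 2 ^ m) = (2::nat) ^ (N + m + 2)" by (simp add: power_add)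
  also have "\<dots> < 2 ^ num_seeds N m" unfolding num_seeds_def by (rule power_strict_increasing) auto
  finally show ?thesis .
qed

lemma good_table_exists: "\<exists>t. good_table N m t"
proof -
  obtain H :: "nat \<Rightarrow> nat \<Rightarrow> nat" where H: "\<And>r x. r < num_seeds N m \<Longrightarrow> x < 2 ^ (N + 1) \<Longrightarrow> H r x < 2 ^ m"
    "\<And>Y. Y \<subseteq> {..<2 ^ m} \<Longrightarrow> 2 * card Y \<le> 2 ^ m \<Longrightarrow>
     card {x. x < 2 ^ (N + 1) \<and> (\<exists>p<2 ^ m. \<forall>r<num_seeds N m. (p + H r x) mod 2 ^ m \<in> Y)} < 2 ^ m"
    using table_exists[OF _ num_seeds_large[of N m]] by auto
  define A where "A = (2::nat) ^ (N + 1)"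
  have A: "0 < A" by (simp add: A_def)
  \<comment> \<open>The table is stored row by row: digit \<open>i\<close> belongs to seed
    \<open>i div A\<close> and input \<open>i mod A\<close>.\<close>
  have Hi: "H (i div A) (i mod A) < 2 ^ m" if "i < num_seeds N m * A" for i
    using that A by (intro H(1)) (auto simp: A_def less_mult_imp_div_less)
  obtain t where t: "\<And>i. i < num_seeds N m * A \<Longrightarrow> t div (2 ^ m) ^ i mod 2 ^ m = H (i div A) (i mod A)"
    using digits_exist[of "num_seeds N m * A" "\<lambda>i. H (i div A) (i mod A)", OF Hi] by auto
  have dig: "table_entry t N m r x = H r x" if "r < num_seeds N m" "x < A" for r x
  proof -
    have "r * A + x < (r + 1) * A" using that by simp
    also have "\<dots> \<le> num_seeds N m * A" using that by (intro mult_right_mono) auto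
    finally show ?thesis using t[of "r * A + x"] that unfolding table_entry_def A_def[symmetric] by simp
  qed
  have "good_table N m t" unfolding good_table_def
  proof (intro allI impI)
    fix B :: nat assume B: "2 * (\<Sum>i<2 ^ m. B div 2 ^ i mod 2) \<le> 2 ^ m"
    define Y where "Y = {i. i < 2 ^ m \<and> B div 2 ^ i mod 2 = 1}"
    have "(\<Sum>i<2 ^ m. B div 2 ^ i mod 2) = (\<Sum>i<2 ^ m. of_bool (i \<in> Y))"
      by (rule sum.cong) (auto simp: Y_def)
    also have "\<dots> = card Y" by (auto simp: Y_def intro!: arg_cong[of _ _ card])
    finally have "card {x. x < 2 ^ (N + 1) \<and> (\<exists>p<2 ^ m. \<forall>r<num_seeds N m. (p + H r x) mod 2 ^ m \<in> Y)} < 2 ^ m"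
      using B by (intro H(2)) (auto simp: Y_def)
    also have "{x. x < 2 ^ (N + 1) \<and> (\<exists>p<2 ^ m. \<forall>r<num_seeds N m. (p + H r x) mod 2 ^ m \<in> Y)} =
      {x. x < 2 ^ (N + 1) \<and> (\<exists>p<2 ^ m. \<forall>r<num_seeds N m. B div 2 ^ ((p + table_entry t N m r x) mod 2 ^ m) mod 2 = 1)}"
      using dig by (auto simp: Y_def A_def)
    finally show "(\<Sum>x<2 ^ (N + 1). of_bool (\<exists>p<2 ^ m. \<forall>r<num_seeds N m. B div 2 ^ ((p + table_entry t N m r x) mod 2 ^ m) mod 2 = 1)) < (2::nat) ^ m"
      by (simp add: Collect_conj_eq lessThan_def)
  qed
  then show ?thesis ..
qed

text \<open>Taking the first good table fixes it by \<open>N\<close> and \<open>m\<close> alone. The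
  search is effective because goodness quantifies over bit masks below a bound, so the table costs
  no program bits beyond these two parameters.\<close>

definition hash :: "nat \<Rightarrow> nat \<Rightarrow> nat \<Rightarrow> nat \<Rightarrow> nat" where
  "hash N m r x = table_entry (LEAST t. good_table N m t) N m r x"

lemma computable_hash [computable_intros]:
  assumes "computable n a" "computable n b" "computable n c" "computable n d" shows "computable n (\<lambda>e. hash (a e) (b e) (c e) (d e))"
proof -
  have t: "computable 2 (\<lambda>e. LEAST t. good_table (e 0) (e 1) t)"
  proof (rule computable_mu)
    show "decidable (Suc 2) (\<lambda>e. good_table (e (Suc 0)) (e (Suc 1)) (e 0))"
      unfolding good_table_def table_entry_def num_seeds_def by (intro computable_intros; simp)
  qed (rule good_table_exists)
  have "computable 4 (\<lambda>e. hash (e 0) (e 1) (e 2) (e 3))"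
    unfolding hash_def table_entry_def by (intro computable_intros computable_comp2[OF t]; simp)
  from computable_comp4[OF this assms] show ?thesis .
qed

lemma hash_sparse:
  assumes "Y \<subseteq> {..<2 ^ m}" "2 * card Y \<le> 2 ^ m"
  shows "card {x. x < 2 ^ (N + 1) \<and> (\<exists>p<2 ^ m. \<forall>r<num_seeds N m. (p + hash N m r x) mod 2 ^ m \<in> Y)} < 2 ^ m"
proof -
  obtain B :: nat where B: "B < 2 ^ 2 ^ m" "\<And>i. i < 2 ^ m \<Longrightarrow> B div 2 ^ i mod 2 = of_bool (i \<in> Y)"
    using digits_exist[of "2 ^ m" "\<lambda>i. of_bool (i \<in> Y)" 2] by fastforce
  have t: "good_table N m (LEAST t. good_table N m t)" by (rule LeastI_ex[OF good_table_exists])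
  have card: "(\<Sum>i<2 ^ m. B div 2 ^ i mod 2) = card Y"
    using B(2) assms(1) by (simp add: Int_absorb1 Int_absorb2)
  have *: "(\<Sum>x<2 ^ (N + 1). of_bool (\<exists>p<2 ^ m. \<forall>r<num_seeds N m. B div 2 ^ ((p + hash N m r x) mod 2 ^ m) mod 2 = 1)) < (2::nat) ^ m"
    unfolding hash_def by (rule good_tableD[OF t B(1)]) (simp only: card assms(2))
  have B': "B div 2 ^ (k mod 2 ^ m) mod 2 = 1 \<longleftrightarrow> k mod 2 ^ m \<in> Y" for k
    by (subst B(2)) auto
  have "(\<Sum>x<2 ^ (N + 1). of_bool (P x) :: nat) = card {x. x < 2 ^ (N + 1) \<and> P x}" for P :: "nat \<Rightarrow> bool"
    by (simp add: Collect_conj_eq lessThan_def)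
  from *[unfolded B' this] show ?thesis .
qed

section \<open>The choice of the string\<close>

lemma prod_encode_poly:
  assumes "2 \<le> N" "a \<le> N ^ K" "b \<le> N ^ K"
  shows "prod_encode (a, b) \<le> N ^ (2 * K + 4)"
proof -
  have le: "triangle n \<le> n * n" for n unfolding triangle_def by (cases n) auto
  have "1 \<le> N ^ K" using assms by simp
  have "a + b \<le> 2 * N ^ K" using assms by simp
  then have "triangle (a + b) + a \<le> (2 * N ^ K) * (2 * N ^ K) + N ^ K"
    by (intro add_mono order.trans[OF le] mult_mono assms) auto
  also have "\<dots> \<le> 8 * (N ^ K * N ^ K)" using \<open>1 \<le> N ^ K\<close> by simp
  \<comment> \<open>Since \<open>2 \<le> N\<close>, the constant 8 is absorbed by
    \<open>N ^ 4\<close>.\<close>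
  also have "\<dots> \<le> N ^ 4 * (N ^ K * N ^ K)"
    using power_mono[OF assms(1), of 4] by (intro mult_right_mono) auto
  also have "\<dots> = N ^ (2 * K + 4)" unfolding power_add mult_2 by (simp only: mult.commute mult.left_commute)
  finally show ?thesis by (simp add: prod_encode_def)
qed

text \<open>The additional 1 in the factor pays for \<open>n + 1 \<le> 2 * N ^ K\<close>, as
  \<open>2 \<le> N\<close>.\<close>

lemma length_dec_log:
  assumes "2 \<le> N" "n \<le> N ^ K"
  shows "real (length (decode n)) \<le> (real K + 1) * log 2 N"
proof -
  have "2 ^ length (decode n) \<le> n + 1" using enc_length(1)[of "decode n"] by simp
  also have "n + 1 \<le> N ^ K + N ^ K" using assms by (intro add_mono) auto
  also have "\<dots> \<le> N ^ (K + 1)" using assms by (simp add: mult_2[symmetric])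
  finally have "2 ^ length (decode n) \<le> N ^ (K + 1)" .
  then have "real (2 ^ length (decode n)) \<le> real (N ^ (K + 1))" by (rule of_nat_mono)
  then have "log 2 (2 ^ length (decode n)) \<le> log 2 (real N ^ (K + 1))"
    using assms by (subst log_le_cancel_iff) auto
  also have "log 2 (real N ^ (K + 1)) = (real K + 1) * log 2 N"
    by (subst log_nat_power) (use assms in auto)
  finally show ?thesis by (simp add: log_nat_power)
qed

section \<open>Complexity bounds: literal programs, unmasking, and the two density cases\<close>

lemma KS_bound:
  assumes "optimal_dec U"
  shows "\<exists>C. \<forall>x y. KS U x y \<le> length x + C \<and> (\<exists>p. U p y = Some x)"
proof -
  \<comment> \<open>The enumeration that lists only \<open>q\<close> itself, used with
    \<open>k = 0\<close>, prints a string literally.\<close>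
  have "decidable 5 (\<lambda>e. e 4 = e 2)" by (rule computable_intros | simp)+
  from KS_enum[where R = "\<lambda>s w q y x. x = q", OF assms this]
  obtain C where *: "\<forall>k w q y x X. finite X \<longrightarrow> card X \<le> 2 ^ k \<longrightarrow>
      (\<forall>s::nat. \<forall>x'. x' = enc q \<longrightarrow> x' \<in> X) \<longrightarrow> (\<exists>s::nat. enc x = enc q) \<longrightarrow>
      KS U x y \<le> k + length q + 2 * length (decode (prod_encode (k, w))) + C \<and> (\<exists>p. U p y = Some x)" ..
  have C: "KS U x y \<le> 0 + length x + 2 * length (decode (prod_encode (0, 0))) + C \<and> (\<exists>p. U p y = Some x)" for x y
    by (rule *[rule_format, of "{enc x}"]) auto
  show ?thesis
    by (rule exI[of _ "2 * length (decode (prod_encode (0, 0))) + C"]) (use C in \<open>simp add: add.assoc\<close>)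
qed

lemma KS_attained:
  assumes "optimal_dec U" obtains p where "length p = KS U x y" "U p y = Some x"
proof -
  have "\<exists>n p. length p = n \<and> U p y = Some x" using KS_bound[OF assms] by blast
  then have "\<exists>p. length p = KS U x y \<and> U p y = Some x" unfolding KS_def by (rule LeastI_ex)
  then show ?thesis using that by blast
qed

text \<open>Knowing \<open>a\<close> and the seed, the hash value can be cancelled from
  \<open>f\<close>, which restores the program \<open>p\<close>. The enumeration has one element and
  \<open>q\<close> is empty, so only the parameters are paid for.\<close>

lemma KS_recover:
  assumes U: "optimal_dec U" and F: "\<And>p y z. U p y = Some z \<longleftrightarrow> eval F [enc p, enc y] (enc z)"
  shows "\<exists>C. \<forall>N m r a b p f i. U p a = Some b \<longrightarrow> i < 2 ^ m \<longrightarrow> enc p + 1 = 2 ^ m + i \<longrightarrow>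
     enc f + 1 = 2 ^ m + (i + hash N m r (enc a)) mod 2 ^ m \<longrightarrow>
     KS U b (pair_str a f) \<le> 2 * length (decode (prod_encode (0, prod_encode (N, prod_encode (m, r))))) + C"
proof -
  \<comment> \<open>The mask is removed by trying all \<open>i\<close>; \<open>2 ^ m + i - 1\<close>
    is the code of the string of length \<open>m\<close> with index \<open>i\<close>.\<close>
  define G where "G N m r s y x \<longleftrightarrow> (\<exists>a<Suc y. \<exists>f<Suc y. pair_code a f = y \<and> (\<exists>i<2 ^ m.
    f + 1 = 2 ^ m + (i + hash N m r a) mod 2 ^ m \<and> clocked F s [2 ^ m + i - 1, a] = Suc x))"
    for N m r s y x
  define R where "R s w q y x \<longleftrightarrow> G (fst (prod_decode w)) (fst (prod_decode (snd (prod_decode w))))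
     (snd (prod_decode (snd (prod_decode w)))) s y x" for s w q y x :: nat
  have "decidable 5 (\<lambda>e. R (e 0) (e 1) (e 2) (e 3) (e 4))"
    unfolding R_def G_def by (intro computable_intros; simp)
  from KS_enum[OF U this] obtain C where C: "\<forall>k w q y x X. finite X \<longrightarrow> card X \<le> 2 ^ k \<longrightarrow>
      (\<forall>s x'. R s w (enc q) (enc y) x' \<longrightarrow> x' \<in> X) \<longrightarrow> (\<exists>s. R s w (enc q) (enc y) (enc x)) \<longrightarrow>
     KS U x y \<le> k + length q + 2 * length (decode (prod_encode (k, w))) + C \<and> (\<exists>p. U p y = Some x)" ..
  show ?thesis
  proof (intro exI[of _ C] allI impI)
    fix N m r a b p f i
    assume p: "U p a = Some b" "i < 2 ^ m" "enc p + 1 = 2 ^ m + i"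
      and f: "enc f + 1 = 2 ^ m + (i + hash N m r (enc a)) mod 2 ^ m"
    have p': "2 ^ m + i - 1 = enc p" using p(3) by simp
    obtain s where s: "clocked F s [enc p, enc a] = Suc (enc b)" using p(1) F eval_iff_ck by blast
    let ?y = "enc (pair_str a f)"
    have uniq: "x = enc b" if "G N m r s' ?y x" for s' x
    proof -
      from that obtain a' f' i' where *: "pair_code a' f' = ?y" "i' < 2 ^ m"
        "f' + 1 = 2 ^ m + (i' + hash N m r a') mod 2 ^ m" "clocked F s' [2 ^ m + i' - 1, a'] = Suc x"
        unfolding G_def by blast
      then have af: "a' = enc a" "f' = enc f" using pair_code_inj unfolding pair_code_enc[symmetric] by blast+
      with * f have "(i' + hash N m r (enc a)) mod 2 ^ m = (i + hash N m r (enc a)) mod 2 ^ m" by simp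
      then have "i' = i" using mod_add_left_cancel p(2) *(2) by (metis add.commute)
      from *(4) have "clocked F s' [enc p, enc a] = Suc x" by (simp only: af \<open>i' = i\<close> p')
      then show ?thesis using s by (rule clocked_det)
    qed
    have ex: "G N m r s ?y (enc b)"
      unfolding G_def
      by (rule exI[of _ "enc a"], rule conjI, simp add: pair_code_enc[symmetric] less_Suc_eq_le pair_code_ge,
          rule exI[of _ "enc f"], rule conjI, simp add: pair_code_enc[symmetric] less_Suc_eq_le pair_code_ge)
        (use p f s p' pair_code_enc in auto)
    have "KS U b (pair_str a f) \<le> 0 + length ([] :: bstr) +
       2 * length (decode (prod_encode (0, prod_encode (N, prod_encode (m, r))))) + C \<and> (\<exists>q. U q (pair_str a f) = Some b)"
    proof (rule C[rule_format, of "{enc b}"])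
      show "x \<in> {enc b}" if "R s' (prod_encode (N, prod_encode (m, r))) (enc []) ?y x" for s' x
        using uniq[of s' x] that unfolding R_def by simp
      show "\<exists>s. R s (prod_encode (N, prod_encode (m, r))) (enc []) ?y (enc b)"
        using ex unfolding R_def by (intro exI[of _ s]) simp
    qed simp_all
    then show "KS U b (pair_str a f) \<le> 2 * length (decode (prod_encode (0, prod_encode (N, prod_encode (m, r))))) + C"
      by simp
  qed
qed

text \<open>The \<open>i\<close> for which the \<open>i\<close>-th string \<open>f\<close> of length \<open>m\<close> gives \<open>x\<close> complexity less than \<open>j\<close>
  relative to the pair of \<open>y\<close> and \<open>f\<close>.\<close>

definition revealing :: "recf \<Rightarrow> nat \<Rightarrow> nat \<Rightarrow> nat \<Rightarrow> nat \<Rightarrow> nat set" where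
  "revealing F m j y x = {i. i < 2 ^ m \<and> (\<exists>q<2 ^ j. \<exists>s. clocked F s [q, pair_code y (2 ^ m - 1 + i)] = Suc x)}"

text \<open>Double counting: a pair of an index below \<open>2 ^ m\<close> and a program code below
  \<open>2 ^ j\<close> yields at most one output, while each output counted here uses at least half
  of the indices.\<close>

lemma card_heavy:
  "finite {x. 2 ^ m \<le> 2 * card (revealing F m j y x)} \<and> card {x. 2 ^ m \<le> 2 * card (revealing F m j y x)} \<le> 2 ^ (j + 1)"
proof -
  let ?V = "revealing F m j y"
  define X where "X = {x. 2 ^ m \<le> 2 * card (?V x)}"
  define val where "val = (\<lambda>(i, q). (THE x. \<exists>s. clocked F s [q, pair_code y (2 ^ m - 1 + i)] = Suc x, i))"
  have "Sigma X ?V \<subseteq> val ` ({..<2 ^ m} \<times> {..<2 ^ j})"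
  proof safe
    fix x i assume "i \<in> ?V x"
    then obtain q s where *: "i < 2 ^ m" "q < 2 ^ j" "clocked F s [q, pair_code y (2 ^ m - 1 + i)] = Suc x"
      unfolding revealing_def by blast
    then have "(THE x. \<exists>s. clocked F s [q, pair_code y (2 ^ m - 1 + i)] = Suc x) = x"
      using clocked_det by blast
    then have "(x, i) = val (i, q)" by (simp add: val_def)
    then show "(x, i) \<in> val ` ({..<2 ^ m} \<times> {..<2 ^ j})" using * by blast
  qed
  moreover have "finite ({..<2 ^ m :: nat} \<times> {..<2 ^ j :: nat})" by simp
  ultimately have fin: "finite (Sigma X ?V)" and "card (Sigma X ?V) \<le> card ({..<2 ^ m :: nat} \<times> {..<2 ^ j :: nat})"
    by (rule finite_surj[rotated], rule surj_card_le[rotated])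
  then have le: "card (Sigma X ?V) \<le> 2 ^ m * 2 ^ j" by (simp add: card_cartesian_product)
  have ne: "?V x \<noteq> {}" if "x \<in> X" for x using that by (auto simp: X_def)
  have finX: "finite X"
  proof (rule finite_subset[OF _ finite_imageI[OF fin, of fst]])
    show "X \<subseteq> fst ` Sigma X ?V" using ne by force
  qed
  have "card X * 2 ^ m = (\<Sum>x\<in>X. 2 ^ m)" by simp
  also have "\<dots> \<le> (\<Sum>x\<in>X. 2 * card (?V x))" by (rule sum_mono) (simp add: X_def)
  also have "\<dots> = 2 * card (Sigma X ?V)"
    using finX by (subst card_SigmaI) (auto simp: revealing_def sum_distrib_left)
  also have "\<dots> \<le> 2 ^ (j + 1) * 2 ^ m" using le by (simp add: mult.commute)
  finally have "card X \<le> 2 ^ (j + 1)" by simp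
  with finX show ?thesis by (simp add: X_def)
qed

text \<open>An output is listed once some stage confirms half of the indices. By
  \<open>card_heavy\<close> the list, enumerable from \<open>c\<close>, has at most
  \<open>2 ^ (j + 1)\<close> members, so \<open>j + 1\<close> bits select \<open>b\<close>.\<close>

lemma KS_heavy:
  assumes U: "optimal_dec U" and F: "\<And>p y z. U p y = Some z \<longleftrightarrow> eval F [enc p, enc y] (enc z)"
  shows "\<exists>C. \<forall>N m j b c. 2 ^ m \<le> 2 * card (revealing F m j (enc c) (enc b)) \<longrightarrow>
     KS U b c \<le> j + 1 + 2 * length (decode (prod_encode (j + 1, prod_encode (N, prod_encode (m, j))))) + C"
proof -
  define G where "G m j s y x \<longleftrightarrow> 2 ^ m \<le> 2 * (\<Sum>i<2 ^ m. of_bool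
    (\<exists>q<2 ^ j. clocked F s [q, pair_code y (2 ^ m - 1 + i)] = Suc x) :: nat)" for m j s y x
  define R where "R s w q y x \<longleftrightarrow> G (fst (prod_decode (snd (prod_decode w))))
     (snd (prod_decode (snd (prod_decode w)))) s y x" for s w q y x :: nat
  have "decidable 5 (\<lambda>e. R (e 0) (e 1) (e 2) (e 3) (e 4))"
    unfolding R_def G_def by (intro computable_intros; simp)
  from KS_enum[OF U this] obtain C where C: "\<forall>k w q y x X. finite X \<longrightarrow> card X \<le> 2 ^ k \<longrightarrow>
      (\<forall>s x'. R s w (enc q) (enc y) x' \<longrightarrow> x' \<in> X) \<longrightarrow> (\<exists>s. R s w (enc q) (enc y) (enc x)) \<longrightarrow>
     KS U x y \<le> k + length q + 2 * length (decode (prod_encode (k, w))) + C \<and> (\<exists>p. U p y = Some x)" ..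
  have sum: "(\<Sum>i<2 ^ m. of_bool (P i) :: nat) = card {i. i < 2 ^ m \<and> P i}" for m and P :: "nat \<Rightarrow> bool"
    by (simp add: Collect_conj_eq lessThan_def)
  show ?thesis
  proof (intro exI[of _ C] allI impI)
    fix N m j b c
    assume heavy: "2 ^ m \<le> 2 * card (revealing F m j (enc c) (enc b))"
    have sub: "2 ^ m \<le> 2 * card (revealing F m j y x)" if "G m j s y x" for s y x
    proof -
      have "card {i. i < 2 ^ m \<and> (\<exists>q<2 ^ j. clocked F s [q, pair_code y (2 ^ m - 1 + i)] = Suc x)} \<le> card (revealing F m j y x)"
        by (rule card_mono) (auto simp: revealing_def)
      then show ?thesis using that unfolding G_def sum by linarith
    qed
    \<comment> \<open>The indices are finitely many, so one stage confirms all of them.\<close>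
    have "\<exists>s\<ge>0. \<forall>i<2 ^ m. i \<in> revealing F m j (enc c) (enc b) \<longrightarrow>
        (\<exists>q<2 ^ j. clocked F s [q, pair_code (enc c) (2 ^ m - 1 + i)] = Suc (enc b))"
    proof (rule uniform_stage)
      show "\<exists>s. i \<in> revealing F m j (enc c) (enc b) \<longrightarrow>
        (\<exists>q<2 ^ j. clocked F s [q, pair_code (enc c) (2 ^ m - 1 + i)] = Suc (enc b))" for i
        unfolding revealing_def by blast
    qed (use clocked_mono in blast)
    then obtain s where s: "\<And>i. i \<in> revealing F m j (enc c) (enc b) \<Longrightarrow>
        (\<exists>q<2 ^ j. clocked F s [q, pair_code (enc c) (2 ^ m - 1 + i)] = Suc (enc b))"
      unfolding revealing_def by blast
    have "card (revealing F m j (enc c) (enc b)) \<le>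
        card {i. i < 2 ^ m \<and> (\<exists>q<2 ^ j. clocked F s [q, pair_code (enc c) (2 ^ m - 1 + i)] = Suc (enc b))}"
      by (rule card_mono) (use s in \<open>auto simp: revealing_def\<close>)
    then have ex: "G m j s (enc c) (enc b)" using heavy unfolding G_def sum by linarith
    have "KS U b c \<le> (j + 1) + length ([] :: bstr) +
       2 * length (decode (prod_encode (j + 1, prod_encode (N, prod_encode (m, j))))) + C \<and> (\<exists>q. U q c = Some b)"
    proof (rule C[rule_format, of "{x. 2 ^ m \<le> 2 * card (revealing F m j (enc c) x)}"])
      show "x \<in> {x. 2 ^ m \<le> 2 * card (revealing F m j (enc c) x)}"
        if "R s' (prod_encode (N, prod_encode (m, j))) (enc []) (enc c) x" for s' x
        using sub[of s' "enc c" x] that unfolding R_def by simp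
      show "\<exists>s. R s (prod_encode (N, prod_encode (m, j))) (enc []) (enc c) (enc b)"
        using ex unfolding R_def by (intro exI[of _ s]) simp
    qed (use card_heavy[of m F j "enc c"] in blast)+
    then show "KS U b c \<le> j + 1 + 2 * length (decode (prod_encode (j + 1, prod_encode (N, prod_encode (m, j))))) + C"
      by simp
  qed
qed

text \<open>Since \<open>q\<close> gives \<open>b\<close> from \<open>c\<close>, one can enumerate
  from \<open>c\<close> and \<open>q\<close> the inputs for which some offset lands in the revealing
  set of \<open>b\<close> under every seed. By \<open>hash_sparse\<close> there are fewer than
  \<open>2 ^ m\<close> of them, so \<open>m\<close> further bits select \<open>a\<close>.\<close>

lemma KS_light:
  assumes U: "optimal_dec U" and F: "\<And>p y z. U p y = Some z \<longleftrightarrow> eval F [enc p, enc y] (enc z)"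
  shows "\<exists>C. \<forall>N m j a b c q i. U q c = Some b \<longrightarrow> length a \<le> N \<longrightarrow>
     2 * card (revealing F m j (enc c) (enc b)) \<le> 2 ^ m \<longrightarrow> i < 2 ^ m \<longrightarrow>
     (\<forall>r<num_seeds N m. (i + hash N m r (enc a)) mod 2 ^ m \<in> revealing F m j (enc c) (enc b)) \<longrightarrow>
     KS U a c \<le> m + length q + 2 * length (decode (prod_encode (m, prod_encode (N, prod_encode (m, j))))) + C"
proof -
  \<comment> \<open>Comparison with the output of \<open>q\<close> replaces any mention of
    \<open>b\<close>. The first conjunct excludes a match between two missing results.\<close>
  define G where "G N m j s q y x \<longleftrightarrow> clocked F s [q, y] \<noteq> 0 \<and> x < 2 ^ (N + 1) \<and>
    (\<exists>i<2 ^ m. \<forall>r<num_seeds N m. \<exists>q'<2 ^ j.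
       clocked F s [q', pair_code y (2 ^ m - 1 + (i + hash N m r x) mod 2 ^ m)] = clocked F s [q, y])" for N m j s q y x
  define R where "R s w q y x \<longleftrightarrow> G (fst (prod_decode w)) (fst (prod_decode (snd (prod_decode w))))
     (snd (prod_decode (snd (prod_decode w)))) s q y x" for s w q y x :: nat
  have "decidable 5 (\<lambda>e. R (e 0) (e 1) (e 2) (e 3) (e 4))"
    unfolding R_def G_def num_seeds_def by (intro computable_intros; simp)
  from KS_enum[OF U this] obtain C where C: "\<forall>k w q y x X. finite X \<longrightarrow> card X \<le> 2 ^ k \<longrightarrow>
      (\<forall>s x'. R s w (enc q) (enc y) x' \<longrightarrow> x' \<in> X) \<longrightarrow> (\<exists>s. R s w (enc q) (enc y) (enc x)) \<longrightarrow>
     KS U x y \<le> k + length q + 2 * length (decode (prod_encode (k, w))) + C \<and> (\<exists>p. U p y = Some x)" ..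
  show ?thesis
  proof (intro exI[of _ C] allI impI)
    fix N m j a b c q i
    assume q: "U q c = Some b" and a: "length a \<le> N" and i: "i < 2 ^ m"
      and light: "2 * card (revealing F m j (enc c) (enc b)) \<le> 2 ^ m"
      and rev: "\<forall>r<num_seeds N m. (i + hash N m r (enc a)) mod 2 ^ m \<in> revealing F m j (enc c) (enc b)"
    let ?V = "revealing F m j (enc c) (enc b)"
    define X where "X = {x. x < 2 ^ (N + 1) \<and> (\<exists>i<2 ^ m. \<forall>r<num_seeds N m. (i + hash N m r x) mod 2 ^ m \<in> ?V)}"
    have X: "finite X" "card X \<le> 2 ^ m"
    proof -
      have "?V \<subseteq> {..<2 ^ m}" by (auto simp: revealing_def)
      from hash_sparse[OF this light, of N] show "finite X" "card X \<le> 2 ^ m" by (simp_all add: X_def)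
    qed
    obtain s0 where s0: "clocked F s0 [enc q, enc c] = Suc (enc b)" using q F eval_iff_ck by blast
    have sub: "x \<in> X" if "G N m j s (enc q) (enc c) x" for s x
    proof -
      from that obtain v where v: "clocked F s [enc q, enc c] = Suc v"
        unfolding G_def by (auto simp: gr0_conv_Suc)
      with s0 have "v = enc b" using clocked_det by blast
      with v that obtain i' where i': "i' < 2 ^ m" "\<forall>r<num_seeds N m. \<exists>q'<2 ^ j.
         clocked F s [q', pair_code (enc c) (2 ^ m - 1 + (i' + hash N m r x) mod 2 ^ m)] = Suc (enc b)"
        unfolding G_def by auto
      have "\<forall>r<num_seeds N m. (i' + hash N m r x) mod 2 ^ m \<in> ?V"
        using i'(2) unfolding revealing_def mem_Collect_eq by (meson mod_less_divisor zero_less_power pos2)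
      then show ?thesis using that i'(1) unfolding X_def G_def by blast
    qed
    \<comment> \<open>From stage \<open>s0\<close> on, the reference computation of \<open>q\<close>
      has its result.\<close>
    have "\<exists>s\<ge>s0. \<forall>r<num_seeds N m. \<exists>q'<2 ^ j.
       clocked F s [q', pair_code (enc c) (2 ^ m - 1 + (i + hash N m r (enc a)) mod 2 ^ m)] = Suc (enc b)"
    proof (rule uniform_stage)
      show "\<exists>s. \<exists>q'<2 ^ j.
       clocked F s [q', pair_code (enc c) (2 ^ m - 1 + (i + hash N m r (enc a)) mod 2 ^ m)] = Suc (enc b)" if "r < num_seeds N m" for r
        using rev that unfolding revealing_def by blast
    qed (use clocked_mono in blast)
    then obtain s where s: "s \<ge> s0" "\<forall>r<num_seeds N m. \<exists>q'<2 ^ j.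
       clocked F s [q', pair_code (enc c) (2 ^ m - 1 + (i + hash N m r (enc a)) mod 2 ^ m)] = Suc (enc b)" by blast
    have "enc a < 2 ^ (N + 1)" using a unfolding length_le_iff by simp
    then have ex: "G N m j s (enc q) (enc c) (enc a)"
      using s(2) i unfolding G_def clocked_mono[OF s0 s(1)] by auto
    have "KS U a c \<le> m + length q +
       2 * length (decode (prod_encode (m, prod_encode (N, prod_encode (m, j))))) + C \<and> (\<exists>q. U q c = Some a)"
    proof (rule C[rule_format, of X])
      show "x \<in> X" if "R s' (prod_encode (N, prod_encode (m, j))) (enc q) (enc c) x" for s' x
        using sub[of s' x] that unfolding R_def by simp
      show "\<exists>s. R s (prod_encode (N, prod_encode (m, j))) (enc q) (enc c) (enc a)"
        using ex unfolding R_def by (intro exI[of _ s]) simp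
    qed (use X in blast)+
    then show "KS U a c \<le> m + length q + 2 * length (decode (prod_encode (m, prod_encode (N, prod_encode (m, j))))) + C"
      by simp
  qed
qed

text \<open>With all entries at most \<open>N ^ K\<close> for \<open>K = D + 3\<close>, three nested
  pairings raise the exponent to \<open>8 * K + 28\<close>; \<open>length_dec_log\<close> adds
  one.\<close>

lemma length_params:
  assumes "2 \<le> N" "n1 \<le> 2 * N + D" "n2 \<le> 2 * N + D" "n3 \<le> 2 * N + D"
  shows "real (length (decode (prod_encode (n1, prod_encode (N, prod_encode (n2, n3))))))
     \<le> (real (8 * (D + 3) + 29)) * log 2 N"
proof -
  define K where "K = D + 3"
  have p: "2 * N + D \<le> N ^ K"
  proof -
    have "1 * D \<le> N * D" using assms(1) by (intro mult_right_mono) auto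
    then have "2 * N + D \<le> N * (D + 2)" by simp
    also have "D + 2 \<le> 2 ^ (D + 2)" using less_exp[of "D + 2"] by (rule less_imp_le)
    also have "2 ^ (D + 2) \<le> N ^ (D + 2)" by (rule power_mono[OF assms(1)]) simp
    also have "N * N ^ (D + 2) = N ^ K" unfolding K_def power_Suc[symmetric] by (rule arg_cong[of _ _ "(^) N"]) simp
    finally show ?thesis by simp
  qed
  have mono: "n \<le> N ^ k'" if "n \<le> N ^ k" "k \<le> k'" for n k k'
    using that(1) power_increasing[OF that(2), of N] assms(1) by linarith
  have "N \<le> N ^ (2 * K + 4)" by (rule mono[of N 1]) simp_all
  moreover have "prod_encode (n2, n3) \<le> N ^ (2 * K + 4)"
    by (intro prod_encode_poly assms(1) order.trans[OF assms(3) p] order.trans[OF assms(4) p])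
  ultimately have "prod_encode (N, prod_encode (n2, n3)) \<le> N ^ (2 * (2 * K + 4) + 4)"
    by (rule prod_encode_poly[OF assms(1)])
  moreover have "n1 \<le> N ^ (2 * (2 * K + 4) + 4)"
    by (rule mono[OF order.trans[OF assms(2) p]]) simp
  ultimately have "prod_encode (n1, prod_encode (N, prod_encode (n2, n3))) \<le> N ^ (2 * (2 * (2 * K + 4) + 4) + 4)"
    by (rule prod_encode_poly[OF assms(1), rotated])
  from length_dec_log[OF assms(1) this] show ?thesis unfolding K_def by (simp add: algebra_simps)
qed

section \<open>Choice of the constant and of the seed\<close>

theorem theorem4:
  fixes U :: "bstr \<Rightarrow> bstr \<Rightarrow> bstr option"
  assumes "optimal_dec U"
  shows "\<exists>d::real. \<forall>N::nat. \<forall>a b c :: bstr.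
    N \<ge> 2 \<longrightarrow> length a \<le> N \<longrightarrow> length b \<le> N \<longrightarrow> length c \<le> N \<longrightarrow>
    real (KS U a c) \<ge> real (KS U b c) + real (KS U b a) + d * log 2 N \<longrightarrow>
    (\<exists>f :: bstr. real (length f) \<le> real (KS U b a) + d * log 2 N \<and>
        real (KS U b (pair_str a f)) \<le> d * log 2 N \<and>
        real (KS U b (pair_str c f)) \<ge> real (KS U b c) - d * log 2 N)"
proof -
  obtain F where F: "\<And>p y z. U p y = Some z \<longleftrightarrow> eval F [enc p, enc y] (enc z)"
    using assms unfolding optimal_dec_def computable_dec_def by blast
  obtain C0 where C0: "\<And>x y. KS U x y \<le> length x + C0" using KS_bound[OF assms] by blast
  obtain C1 where C1: "\<forall>N m r a b p f i. U p a = Some b \<longrightarrow> i < 2 ^ m \<longrightarrow> enc p + 1 = 2 ^ m + i \<longrightarrow>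
     enc f + 1 = 2 ^ m + (i + hash N m r (enc a)) mod 2 ^ m \<longrightarrow>
     KS U b (pair_str a f) \<le> 2 * length (decode (prod_encode (0, prod_encode (N, prod_encode (m, r))))) + C1"
    using KS_recover[OF assms F] ..
  obtain C2 where C2: "\<forall>N m j b c. 2 ^ m \<le> 2 * card (revealing F m j (enc c) (enc b)) \<longrightarrow>
     KS U b c \<le> j + 1 + 2 * length (decode (prod_encode (j + 1, prod_encode (N, prod_encode (m, j))))) + C2"
    using KS_heavy[OF assms F] ..
  obtain C3 where C3: "\<forall>N m j a b c q i. U q c = Some b \<longrightarrow> length a \<le> N \<longrightarrow>
     2 * card (revealing F m j (enc c) (enc b)) \<le> 2 ^ m \<longrightarrow> i < 2 ^ m \<longrightarrow>
     (\<forall>r<num_seeds N m. (i + hash N m r (enc a)) mod 2 ^ m \<in> revealing F m j (enc c) (enc b)) \<longrightarrow>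
     KS U a c \<le> m + length q + 2 * length (decode (prod_encode (m, prod_encode (N, prod_encode (m, j))))) + C3"
    using KS_light[OF assms F] ..
  \<comment> \<open>This is \<open>length_params\<close> with \<open>D = C0 + 3\<close>: a seed is
    below \<open>N + m + 3\<close>, hence at most \<open>2 * N + (C0 + 3)\<close>. In
    \<open>d\<close> the factor 2 reflects the doubling of parameters in a pair, and the additive
    constants are absorbed because \<open>1 \<le> log 2 N\<close>.\<close>
  define L where "L = real (8 * (C0 + 3 + 3) + 29)"
  define d where "d = 2 * L + C1 + C2 + C3 + 4"
  show ?thesis
  proof (intro exI[of _ d] allI impI)
    fix N :: nat and a b c
    assume N: "N \<ge> 2" and a: "length a \<le> N" and b: "length b \<le> N"
      and gap: "real (KS U a c) \<ge> real (KS U b c) + real (KS U b a) + d * log 2 N"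
    define m where "m = KS U b a"
    define l where "l = KS U b c"
    have ml: "m \<le> N + C0" "l \<le> N + C0" using C0[of b a] C0[of b c] b by (auto simp: m_def l_def)
    have params: "real (length (decode (prod_encode (n1, prod_encode (N, prod_encode (n2, n3)))))) \<le> L * log 2 N"
      if "n1 \<le> 2 * N + (C0 + 3)" "n2 \<le> 2 * N + (C0 + 3)" "n3 \<le> 2 * N + (C0 + 3)" for n1 n2 n3
      using length_params[OF N that] unfolding L_def .
    have log1: "1 \<le> log 2 N" using N by (subst le_log_iff) auto
    have dlog: "2 * (L * log 2 N) + C1 + C2 + C3 + 4 \<le> d * log 2 N"
    proof -
      have "real (C1 + C2 + C3 + 4) * 1 \<le> (C1 + C2 + C3 + 4) * log 2 N"
        using log1 by (intro mult_left_mono) auto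
      then show ?thesis unfolding d_def by (simp add: algebra_simps)
    qed
    obtain p where p: "length p = m" "U p a = Some b" using KS_attained[OF assms] unfolding m_def by blast
    obtain q where q: "length q = l" "U q c = Some b" using KS_attained[OF assms] unfolding l_def by blast
    \<comment> \<open>The index of \<open>p\<close> among the strings of length \<open>m\<close>;
      the masked index yields a string \<open>f r\<close> of the same length.\<close>
    define i where "i = enc p + 1 - 2 ^ m"
    have i: "i < 2 ^ m" "enc p + 1 = 2 ^ m + i" using enc_length[of p] p(1) by (auto simp: i_def)
    define f where "f r = decode (2 ^ m - 1 + (i + hash N m r (enc a)) mod 2 ^ m)" for r
    have f: "enc (f r) + 1 = 2 ^ m + (i + hash N m r (enc a)) mod 2 ^ m" for r by (simp add: f_def)
    have lf: "length (f r) = m" for r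
      by (rule length_eqI) (simp_all only: f, simp_all)
    have f1: "real (KS U b (pair_str a (f r))) \<le> d * log 2 N" if "r < num_seeds N m" for r
    proof -
      have "KS U b (pair_str a (f r)) \<le> 2 * length (decode (prod_encode (0, prod_encode (N, prod_encode (m, r))))) + C1"
        by (rule C1[rule_format, OF p(2) i f])
      then have "real (KS U b (pair_str a (f r))) \<le> 2 * real (length (decode (prod_encode (0, prod_encode (N, prod_encode (m, r)))))) + real C1"
        by linarith
      moreover have "real (length (decode (prod_encode (0, prod_encode (N, prod_encode (m, r)))))) \<le> L * log 2 N"
        using that ml by (intro params) (auto simp: num_seeds_def)
      ultimately show ?thesis using dlog by linarith
    qed
    \<comment> \<open>Every seed meets the first two requirements, so one seed that keeps
      \<open>b\<close> complex relative to \<open>c\<close> is enough.\<close>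
    have "\<exists>r<num_seeds N m. real (KS U b (pair_str c (f r))) \<ge> real l - d * log 2 N"
    proof (rule ccontr)
      assume "\<not> ?thesis"
      then have bad: "\<And>r. r < num_seeds N m \<Longrightarrow> real (KS U b (pair_str c (f r))) < real l - d * log 2 N" by force
      define s where "s = nat \<lfloor>d * log 2 N\<rfloor>"
      have "0 \<le> L" by (simp add: L_def)
      then have "0 \<le> L * log 2 N" using log1 by simp
      then have dpos: "0 \<le> d * log 2 N" using dlog by linarith
      then have s: "real s \<le> d * log 2 N" "d * log 2 N < real s + 1" by (auto simp: s_def)
      define j where "j = l - s"
      have jlt: "KS U b (pair_str c (f r)) < j" if "r < num_seeds N m" for r
        using bad[OF that] s(1) unfolding j_def by linarith
      have rev: "\<forall>r<num_seeds N m. (i + hash N m r (enc a)) mod 2 ^ m \<in> revealing F m j (enc c) (enc b)"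
      proof (intro allI impI)
        fix r assume r: "r < num_seeds N m"
        obtain q' where q': "length q' = KS U b (pair_str c (f r))" "U q' (pair_str c (f r)) = Some b"
          using KS_attained[OF assms] by blast
        then obtain s where "clocked F s [enc q', enc (pair_str c (f r))] = Suc (enc b)"
          using F eval_iff_ck by blast
        then have "clocked F s [enc q', pair_code (enc c) (2 ^ m - 1 + (i + hash N m r (enc a)) mod 2 ^ m)] = Suc (enc b)"
          unfolding pair_code_enc[symmetric] by (simp add: f_def)
        \<comment> \<open>The strict bound by \<open>j\<close> matters: strings of length at most
          \<open>j - 1\<close> are exactly those with \<open>enc q' + 1 < 2 ^ j\<close>.\<close>
        moreover have "enc q' < 2 ^ j"
        proof -
          have "length q' \<le> j - 1" using q'(1) jlt[OF r] by simp
          then show ?thesis unfolding length_le_iff using jlt[OF r] by simp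
        qed
        ultimately show "(i + hash N m r (enc a)) mod 2 ^ m \<in> revealing F m j (enc c) (enc b)"
          unfolding revealing_def by auto
      qed
      \<comment> \<open>Some complexity lies below \<open>j\<close>, so \<open>j\<close> is positive
        and the truncated difference is exact.\<close>
      have j: "j + s = l" using jlt[of 0] by (auto simp: num_seeds_def j_def)
      show False
      proof (cases "2 ^ m \<le> 2 * card (revealing F m j (enc c) (enc b))")
        \<comment> \<open>Here \<open>b\<close> is one of few enumerable strings, which would force
          the drop \<open>s\<close> from \<open>l\<close> to \<open>j\<close> below
          \<open>d * log 2 N - 1\<close>.\<close>
        case True
        have "l \<le> j + 1 + 2 * length (decode (prod_encode (j + 1, prod_encode (N, prod_encode (m, j))))) + C2"
          using C2 True unfolding l_def by blast
        moreover have "real (length (decode (prod_encode (j + 1, prod_encode (N, prod_encode (m, j)))))) \<le> L * log 2 N"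
          using ml j by (intro params) auto
        ultimately have "real s \<le> 1 + 2 * (L * log 2 N) + C2" using j by linarith
        then show False using s(2) dlog by linarith
      next
        \<comment> \<open>Here \<open>a\<close> is cheap relative to \<open>c\<close>: about
          \<open>m + l\<close> bits suffice, against the assumed gap.\<close>
        case False
        have "KS U a c \<le> m + length q + 2 * length (decode (prod_encode (m, prod_encode (N, prod_encode (m, j))))) + C3"
          by (rule C3[rule_format, OF q(2) a _ i(1)]) (use False rev in auto)
        moreover have "real (length (decode (prod_encode (m, prod_encode (N, prod_encode (m, j)))))) \<le> L * log 2 N"
          using ml j by (intro params) auto
        ultimately have "real (KS U a c) \<le> m + l + 2 * (L * log 2 N) + C3" using q(1) by linarith
        then show False using gap dlog unfolding m_def l_def by linarith
      qed
    qed
    then obtain r where r: "r < num_seeds N m" "real (KS U b (pair_str c (f r))) \<ge> real l - d * log 2 N" by blast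
    have "0 \<le> d * log 2 N" using dlog log1 by (simp add: d_def L_def)
    then show "\<exists>f. real (length f) \<le> real (KS U b a) + d * log 2 N \<and>
        real (KS U b (pair_str a f)) \<le> d * log 2 N \<and>
        real (KS U b (pair_str c f)) \<ge> real (KS U b c) - d * log 2 N"
      using lf[of r] f1[OF r(1)] r(2) by (intro exI[of _ "f r"]) (auto simp: m_def l_def)
  qed
qed

end
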